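(* Let $p,q$ be positive integers, let $X$ in $\mathbb R^p$ and $Y$ in $\mathbb R^q$ be random vectors, and let $(X_1,Y_1),(X_2,Y_2),\dots$ be independent copies of $(X,Y)$; for each $n$ let $(\mathbf X,\mathbf Y)=\{(X_k,Y_k):k=1,\dots,n\}$. If $E|X|_p<\infty$ and $E|Y|_q<\infty$, then almost surely $$\lim_{n\to\infty}\mathcal V_n(\mathbf X,\mathbf Y)=\mathcal V(X,Y).$$
   Context: $|\cdot|_d$ is the Euclidean norm on $\mathbb R^d$. $f_X,f_Y,f_{X,Y}$ denote the characteristic functions of $X$, $Y$ and the joint characteristic function, $f_{X,Y}(t,s)=E e^{i\langle t,X\rangle+i\langle s,Y\rangle}$. Distance covariance: for $X,Y$ with finite first moments, $\mathcal V(X,Y)\ge 0$ is defined by $$\mathcal V^2(X,Y)=\frac1{c_pc_q}\int_{\mathbb R^{p+q}}\frac{|f_{X,Y}(t,s)-f_X(t)f_Y(s)|^2}{|t|_p^{1+p}|s|_q^{1+q}}\,dt\,ds,\qquad c_d=\frac{\pi^{(1+d)/2}}{\Gamma((1+d)/2)}.$$ Empirical distance covariance: put $a_{kl}=|X_k-X_l|_p$, $\bar a_{k\cdot}=\frac1n\sum_{l=1}^n a_{kl}$, $\bar a_{\cdot l}=\frac1n\sum_{k=1}^n a_{kl}$, $\bar a_{\cdot\cdot}=\frac1{n^2}\sum_{k,l=1}^n a_{kl}$, $A_{kl}=a_{kl}-\bar a_{k\cdot}-\bar a_{\cdot l}+\bar a_{\cdot\cdot}$; similarly $b_{kl}=|Y_k-Y_l|_q$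 and $B_{kl}=b_{kl}-\bar b_{k\cdot}-\bar b_{\cdot l}+\bar b_{\cdot\cdot}$, for $k,l=1,\dots,n$. Then $\mathcal V_n(\mathbf X,\mathbf Y)$ is the nonnegative number with $$\mathcal V_n^2(\mathbf X,\mathbf Y)=\frac1{n^2}\sum_{k,l=1}^n A_{kl}B_{kl}$$ (the right-hand side is always nonnegative). *)

theory Defs
  imports "HOL-Probability.Probability"
begin

definition charfun :: "'w measure \<Rightarrow> ('w \<Rightarrow> 'a::euclidean_space) \<Rightarrow> 'a \<Rightarrow> complex" where
  "charfun M X t = (CLINT \<omega>|M. iexp (t \<bullet> X \<omega>))"

definition joint_charfun ::
  "'w measure \<Rightarrow> ('w \<Rightarrow> 'a::euclidean_space) \<Rightarrow> ('w \<Rightarrow> 'b::euclidean_space) \<Rightarrow> 'a \<Rightarrow> 'b \<Rightarrow> complex"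
where
  "joint_charfun M X Y t s =
     (CLINT \<omega>|M. exp (\<i> * complex_of_real (t \<bullet> X \<omega>) + \<i> * complex_of_real (s \<bullet> Y \<omega>)))"

definition dcov_const :: "nat \<Rightarrow> real" where
  "dcov_const d = pi powr ((1 + real d) / 2) / Gamma ((1 + real d) / 2)"

text \<open>
  The Bochner integral below has value 0 by convention if the nonnegative integrand is not
  integrable. Finite first moments of X and Y rule this out: by the Cauchy-Schwarz inequality
  the squared modulus is at most the product of 1 minus the squared modulus of the characteristic
  function of X and the analogous term for Y. Where t or s is 0 (a null set) the
  integrand is 0, since division by zero yields 0.
\<close>

definition dcov ::
  "'w measure \<Rightarrow> ('w \<Rightarrow> 'a::euclidean_space) \<Rightarrow> ('w \<Rightarrow> 'b::euclidean_space) \<Rightarrow> real"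
where
  "dcov M X Y = sqrt (1 / (dcov_const DIM('a) * dcov_const DIM('b)) *
     (LINT (t, s)|(lborel :: ('a \<times> 'b) measure).
          (cmod (joint_charfun M X Y t s - charfun M X t * charfun M Y s))\<^sup>2 /
          (norm t ^ (1 + DIM('a)) * norm s ^ (1 + DIM('b)))))"

text \<open>
  Samples of size n are indexed by 0, ..., n - 1.
\<close>

definition double_centered :: "nat \<Rightarrow> (nat \<Rightarrow> nat \<Rightarrow> real) \<Rightarrow> nat \<Rightarrow> nat \<Rightarrow> real" where
  "double_centered n a k l =
     a k l - 1 / real n * (\<Sum>j<n. a k j) - 1 / real n * (\<Sum>i<n. a i l)
       + 1 / (real n)\<^sup>2 * (\<Sum>i<n. \<Sum>j<n. a i j)"

text \<open>
  The radicand is always nonnegative, so the square root is the intended one.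
\<close>

definition empirical_dcov ::
  "nat \<Rightarrow> (nat \<Rightarrow> 'a::euclidean_space) \<Rightarrow> (nat \<Rightarrow> 'b::euclidean_space) \<Rightarrow> real"
where
  "empirical_dcov n x y = sqrt (1 / (real n)\<^sup>2 * (\<Sum>k<n. \<Sum>l<n.
     double_centered n (\<lambda>i j. norm (x i - x j)) k l *
     double_centered n (\<lambda>i j. norm (y i - y j)) k l))"

end

theory Submission
  imports Defs
begin

text \<open>
  Up to normalisation, \<open>dcov\<close> is the square root of an integral over \<open>(t, s)\<close>, and the empirical
  version is the same functional evaluated at the empirical distribution, that is, at the uniform
  distribution on the first \<open>n\<close> indices (\<open>empirical_dcov_eq_dcov\<close>). So the theorem is a limit passage
  under an integral sign: replace the law of \<open>(X, Y)\<close> by the empirical laws.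

  Pointwise, the strong law of large numbers turns empirical characteristic functions into the true
  ones; Tonelli turns "for each \<open>(t, s)\<close>, almost surely" into "almost surely, for almost every
  \<open>(t, s)\<close>" (\<open>AE_average_tendsto_AE_parameter\<close>). The weight is not integrable near the set where \<open>t\<close> or \<open>s\<close>
  vanishes, so a majorant is needed, and the natural one changes with the sample. By the Cauchy-Schwarz inequality the squared
  modulus in the integrand is at most four times the product of \<open>1 - Re f\<^sub>X(t)\<close> and \<open>1 - Re f\<^sub>Y(s)\<close>
  (\<open>charfun_covariance_bound\<close>). The weighted integral of \<open>1 - Re f\<^sub>X\<close> is a constant times the
  first absolute moment of \<open>X\<close> (\<open>has_bochner_integral_one_minus_charfun\<close>). Hence the integrals of the
  empirical majorants are constant multiples of products of two sample means, which converge to the integral of the limiting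
  majorant by the strong law again. Dominated convergence with such a convergent sequence of
  majorants (\<open>tendsto_integral_dominated_by_convergent\<close>) concludes. Only first moments are used:
  no average over pairs of observations ever has to be controlled.

  Two ingredients are of independent interest. The first is the identity
  \<open>has_bochner_integral_one_minus_cos\<close>, which expresses the Euclidean norm as a weighted integral of
  \<open>1 - cos\<close>; it links distances with characteristic functions and produces the normalising constant.
  The second is the strong law of large numbers for integrable independent identically
  distributed variables, proved by a maximal inequality on the sequence space.
\<close>

section \<open>The Euclidean norm as an integral of cosines\<close>

text \<open>
  Obtained from the characteristic function of the standard normal distribution by scaling.
\<close>

lemma fourier_gaussian_real:
  fixes a r :: real
  assumes r: "r > 0"
  shows "integrable lborel (\<lambda>y. iexp (y * a) * complex_of_real (exp (- (r * y)\<^sup>2 / 2)))" (is "integrable _ ?g")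
    and "(CLBINT y. iexp (y * a) * complex_of_real (exp (- (r * y)\<^sup>2 / 2)))
           = complex_of_real (sqrt (2 * pi) / r * exp (- (a / r)\<^sup>2 / 2))"
proof -
  define f :: "real \<Rightarrow> complex" where "f y = iexp (y * (a / r)) * complex_of_real (exp (- y\<^sup>2 / 2))" for y
  have f_eq: "f y = sqrt (2 * pi) *\<^sub>R (std_normal_density y *\<^sub>R iexp (a / r * y))" for y
    by (simp add: f_def std_normal_density_def scaleR_conv_of_real mult_ac)
  have "integrable lborel (\<lambda>y. std_normal_density y *\<^sub>R iexp (a / r * y))"
    by (rule Bochner_Integration.integrable_bound[OF integrable_normal_density[where \<mu>=0 and \<sigma>=1]])
       (simp_all add: norm_mult del: One_nat_def)
  then have f_int: "integrable lborel f"
    unfolding f_eq[abs_def] by (rule integrable_scaleR_right)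
  have "(CLBINT y. f y) = sqrt (2 * pi) *\<^sub>R char std_normal_distribution (a / r)"
    unfolding f_eq char_def by (simp add: integral_density del: scaleR_scaleR)
  also have "\<dots> = complex_of_real (sqrt (2 * pi) * exp (- (a / r)\<^sup>2 / 2))"
    by (simp add: char_std_normal_distribution scaleR_conv_of_real)
  finally have f_val: "(CLBINT y. f y) = complex_of_real (sqrt (2 * pi) * exp (- (a / r)\<^sup>2 / 2))" .
  have g_eq: "?g = (\<lambda>y. f (0 + r * y))"
    using r by (auto simp: f_def fun_eq_iff)
  show "integrable lborel ?g"
    unfolding g_eq by (rule lborel_integrable_real_affine[OF f_int]) (use r in simp)
  have "(CLBINT y. f y) = r *\<^sub>R (CLBINT y. ?g y)"
    unfolding g_eq using lborel_integral_real_affine[of r f 0] r by simp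
  then show "(CLBINT y. ?g y) = complex_of_real (sqrt (2 * pi) / r * exp (- (a / r)\<^sup>2 / 2))"
    using r by (simp add: f_val scaleR_conv_of_real field_simps)
qed

text \<open>
  The multivariate transform factorises over the coordinates, because both the Gaussian and the
  character are products of functions of one coordinate each.
\<close>
lemma fourier_gaussian:
  fixes x :: "'a::euclidean_space" and r :: real
  assumes r: "r > 0"
  shows "integrable lborel (\<lambda>t::'a. iexp (t \<bullet> x) * complex_of_real (exp (- (r * norm t)\<^sup>2 / 2)))"
    and "(CLINT t|(lborel :: 'a measure). iexp (t \<bullet> x) * complex_of_real (exp (- (r * norm t)\<^sup>2 / 2)))
           = complex_of_real ((sqrt (2 * pi) / r) ^ DIM('a) * exp (- (norm x / r)\<^sup>2 / 2))"
proof -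
  interpret product_sigma_finite "\<lambda>_::'a. lborel :: real measure" ..
  define g :: "'a \<Rightarrow> real \<Rightarrow> complex" where
    "g b y = iexp (y * (x \<bullet> b)) * complex_of_real (exp (- (r * y)\<^sup>2 / 2))" for b y
  define h :: "'a \<Rightarrow> complex" where
    "h t = iexp (t \<bullet> x) * complex_of_real (exp (- (r * norm t)\<^sup>2 / 2))" for t
  have h_meas: "h \<in> borel_measurable borel"
    unfolding h_def by measurable
  have prod_g: "h (\<Sum>b\<in>Basis. y b *\<^sub>R b) = (\<Prod>b\<in>Basis. g b (y b))" for y :: "'a \<Rightarrow> real"
  proof -
    let ?t = "\<Sum>b\<in>Basis. y b *\<^sub>R b"
    have "?t \<bullet> x = (\<Sum>b\<in>Basis. y b * (x \<bullet> b))"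
      by (simp add: euclidean_inner[of ?t x])
    moreover have "- (r * norm ?t)\<^sup>2 / 2 = (\<Sum>b\<in>Basis. - (r * y b)\<^sup>2 / 2)"
    proof -
      have "(norm ?t)\<^sup>2 = (\<Sum>b\<in>Basis. (y b)\<^sup>2)"
        unfolding power2_norm_eq_inner euclidean_inner[of ?t ?t] by (simp add: power2_eq_square)
      then show ?thesis
        by (simp add: power_mult_distrib sum_distrib_left sum_divide_distrib sum_negf)
    qed
    ultimately show ?thesis
      by (simp add: h_def g_def prod.distrib exp_sum sum_distrib_left of_real_sum)
  qed
  have g_int: "integrable lborel (g b)" for b
    unfolding g_def using fourier_gaussian_real(1)[OF r] by simp
  have M: "(\<lambda>f. \<Sum>b\<in>Basis. f b *\<^sub>R b) \<in> measurable (\<Pi>\<^sub>M b\<in>Basis. lborel) (borel :: 'a measure)"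
    by measurable
  have hh: "integrable lborel h"
    unfolding lborel_eq[where 'a='a]
    by (subst integrable_distr_eq[OF M h_meas])
       (simp add: prod_g product_integrable_prod g_int)
  have "integral\<^sup>L lborel h = (\<Prod>b\<in>Basis. integral\<^sup>L lborel (g b))"
    unfolding lborel_eq[where 'a='a]
    by (subst integral_distr[OF M h_meas])
       (simp add: prod_g product_integral_prod g_int)
  also have "\<dots> = (\<Prod>b\<in>Basis. complex_of_real (sqrt (2 * pi) / r * exp (- ((x \<bullet> b) / r)\<^sup>2 / 2)))"
    unfolding g_def using fourier_gaussian_real(2)[OF r] by simp
  also have "\<dots> = complex_of_real ((sqrt (2 * pi) / r) ^ DIM('a) * exp (\<Sum>b\<in>Basis. - ((x \<bullet> b) / r)\<^sup>2 / 2))"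
    by (simp add: prod.distrib exp_sum power_divide prod_dividef)
  also have "(\<Sum>b\<in>Basis. - ((x \<bullet> b) / r)\<^sup>2 / 2) = - (norm x / r)\<^sup>2 / 2"
    by (simp add: power_divide euclidean_inner[of x x] flip: sum_divide_distrib)
       (simp add: norm_eq_sqrt_inner euclidean_inner[of x x] sum_nonneg power2_eq_square sum_negf sum_divide_distrib)
  finally show "integrable lborel (\<lambda>t::'a. iexp (t \<bullet> x) * complex_of_real (exp (- (r * norm t)\<^sup>2 / 2)))"
    and "(CLINT t|(lborel :: 'a measure). iexp (t \<bullet> x) * complex_of_real (exp (- (r * norm t)\<^sup>2 / 2)))
           = complex_of_real ((sqrt (2 * pi) / r) ^ DIM('a) * exp (- (norm x / r)\<^sup>2 / 2))"
    using hh unfolding h_def by auto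
qed

text \<open>
  The difference of the real part of the Gaussian transform at the frequencies 0 and \<open>x\<close>.
\<close>
lemma nn_integral_one_minus_cos_gaussian:
  fixes x :: "'a::euclidean_space" and r :: real
  assumes r: "r > 0"
  shows "(\<integral>\<^sup>+t. ennreal ((1 - cos (t \<bullet> x)) * exp (- (r * norm t)\<^sup>2 / 2)) \<partial>(lborel :: 'a measure))
           = ennreal ((sqrt (2 * pi) / r) ^ DIM('a) * (1 - exp (- (norm x / r)\<^sup>2 / 2)))"
proof -
  let ?E = "\<lambda>t::'a. exp (- (r * norm t)\<^sup>2 / 2)" and ?c = "(sqrt (2 * pi) / r) ^ DIM('a)"
  have hb: "has_bochner_integral lborel (\<lambda>t::'a. cos (t \<bullet> y) * ?E t) (?c * exp (- (norm y / r)\<^sup>2 / 2))" for y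
  proof -
    have "has_bochner_integral lborel (\<lambda>t::'a. Re (iexp (t \<bullet> y) * complex_of_real (?E t)))
        (Re (complex_of_real (?c * exp (- (norm y / r)\<^sup>2 / 2))))"
      by (intro has_bochner_integral_Re) (use fourier_gaussian[OF r, of y] in \<open>simp only: has_bochner_integral_iff\<close>)
    then show ?thesis
      by (simp add: Re_exp)
  qed
  have "has_bochner_integral lborel (\<lambda>t::'a. ?E t - cos (t \<bullet> x) * ?E t) (?c - ?c * exp (- (norm x / r)\<^sup>2 / 2))"
    using has_bochner_integral_diff[OF hb[of 0] hb[of x]] by simp
  then have "has_bochner_integral lborel (\<lambda>t::'a. (1 - cos (t \<bullet> x)) * ?E t) (?c * (1 - exp (- (norm x / r)\<^sup>2 / 2)))"
    by (simp only: left_diff_distrib right_diff_distrib mult_1 mult_1_right)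
  then show ?thesis
    by (subst nn_integral_eq_integral) (auto simp only: has_bochner_integral_iff, auto)
qed

text \<open>
  The Gamma integral after the substitution of \<open>r\<^sup>2 / 2\<close> for its variable.
\<close>
lemma nn_integral_Gamma_gaussian:
  shows "(\<integral>\<^sup>+r. ennreal (r ^ d * exp (- r\<^sup>2 / 2)) * indicator {0<..} r \<partial>lborel)
           = ennreal (2 powr ((real d - 1) / 2) * Gamma ((1 + real d) / 2))"
proof -
  define s where "s = (1 + real d) / 2"
  have s: "s > 0" by (simp add: s_def)
  let ?f = "\<lambda>t::real. t powr (s - 1) / exp t"
  have hi: "(?f has_integral Gamma s) {0..}"
    by (rule Gamma_integral_real[OF s])
  have "negligible {x \<in> {0..} - {0<..}. ?f x \<noteq> 0}" "negligible {x \<in> {0<..} - {0..}. ?f x \<noteq> 0}"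
    by (rule negligible_subset[of "{0}"], auto)+
  from has_integral_spike_set_eq[OF this] have hi': "(?f has_integral Gamma s) {0<..}"
    using hi by (rule iffD1)
  have ai: "?f absolutely_integrable_on {0<..}"
    by (rule nonnegative_absolutely_integrable_1) (use hi' in auto)
  have im: "(\<lambda>r::real. r\<^sup>2 / 2) ` {0<..} = {0<..}"
  proof (intro equalityI subsetI)
    fix t :: real assume "t \<in> {0<..}"
    then show "t \<in> (\<lambda>r::real. r\<^sup>2 / 2) ` {0<..}"
      by (intro image_eqI[of _ _ "sqrt (2 * t)"]) auto
  qed auto
  have der: "((\<lambda>r. r\<^sup>2 / 2) has_field_derivative r) (at r within {0<..})" for r :: real
    by (auto intro!: derivative_eq_intros)
  have inj: "inj_on (\<lambda>r::real. r\<^sup>2 / 2) {0<..}"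
    by (auto simp: inj_on_def)
  have "(\<lambda>r. \<bar>r\<bar> *\<^sub>R ?f (r\<^sup>2 / 2)) absolutely_integrable_on {0<..} \<and>
      integral {0<..} (\<lambda>r. \<bar>r\<bar> *\<^sub>R ?f (r\<^sup>2 / 2)) = Gamma s"
    using has_absolute_integral_change_of_variables_real[of "{0<..}" "\<lambda>r. r\<^sup>2 / 2" "\<lambda>r. r" ?f "Gamma s"]
      der inj ai hi' by (simp add: im integral_unique)
  then have "((\<lambda>r. \<bar>r\<bar> *\<^sub>R ?f (r\<^sup>2 / 2)) has_integral Gamma s) {0<..}"
    using absolutely_integrable_on_def has_integral_integrable_integral by blast
  then have "((\<lambda>r. 2 powr ((real d - 1) / 2) * (\<bar>r\<bar> *\<^sub>R ?f (r\<^sup>2 / 2))) has_integral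
     2 powr ((real d - 1) / 2) * Gamma s) {0<..}"
    by (rule has_integral_mult_right)
  moreover have "2 powr ((real d - 1) / 2) * (\<bar>r\<bar> *\<^sub>R ?f (r\<^sup>2 / 2)) = r ^ d * exp (- r\<^sup>2 / 2)"
    if "r \<in> {0<..}" for r
  proof -
    have r: "r > 0" using that by simp
    have e: "s - 1 = (real d - 1) / 2" by (simp add: s_def field_simps)
    have "(r\<^sup>2) powr ((real d - 1) / 2) = r powr (real d - 1)"
    proof -
      have "r powr (2 * ((real d - 1) / 2)) = r powr (real d - 1)"
        by (rule arg_cong[where f="(powr) r"]) simp
      then show ?thesis
        using r powr_powr[of r 2 "(real d - 1) / 2"] by (simp del: times_divide_eq_right)
    qed
    then have "2 powr ((real d - 1) / 2) * (r * (r\<^sup>2 / 2) powr (s - 1)) = r * r powr (real d - 1)"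
      using r by (simp add: e powr_divide)
    also have "\<dots> = r powr real d"
      using r powr_add[of r 1 "real d - 1"] by simp
    also have "\<dots> = r ^ d"
      using r by (simp add: powr_realpow)
    finally show ?thesis
      using r by (simp add: exp_minus field_simps)
  qed
  ultimately have "((\<lambda>r. r ^ d * exp (- r\<^sup>2 / 2)) has_integral 2 powr ((real d - 1) / 2) * Gamma s) {0<..}"
    by (metis (no_types, lifting) has_integral_cong)
  from nn_integral_has_integral_lebesgue[OF _ this] have
    "(\<integral>\<^sup>+r. ennreal (indicator {0<..} r * (r ^ d * exp (- r\<^sup>2 / 2))) \<partial>lborel)
           = ennreal (2 powr ((real d - 1) / 2) * Gamma s)"
    by simp
  then show ?thesis
    by (simp only: s_def mult.commute[of "indicator _ _"] ennreal_mult'' indicator_pos_le ennreal_indicator)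
qed

text \<open>
  This writes the weight \<open>1 / a ^ (1 + d)\<close> as a mixture of Gaussians in \<open>a\<close>, the form in which the
  weight can be Fourier-transformed.
\<close>
lemma nn_integral_gaussian_scale:
  assumes a: "a > 0"
  shows "(\<integral>\<^sup>+r. ennreal (r ^ d * exp (- (r * a)\<^sup>2 / 2)) * indicator {0<..} r \<partial>lborel)
           = ennreal (2 powr ((real d - 1) / 2) * Gamma ((1 + real d) / 2) / a ^ (1 + d))"
proof -
  let ?K = "2 powr ((real d - 1) / 2) * Gamma ((1 + real d) / 2)"
  let ?I = "\<integral>\<^sup>+r. ennreal (r ^ d * exp (- (r * a)\<^sup>2 / 2)) * indicator {0<..} r \<partial>lborel"
  have K: "?K \<ge> 0" by (simp add: Gamma_real_nonneg)
  have "ennreal ?K = (\<integral>\<^sup>+r. ennreal (r ^ d * exp (- r\<^sup>2 / 2)) * indicator {0<..} r \<partial>lborel)"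
    by (rule nn_integral_Gamma_gaussian[symmetric])
  also have "\<dots> = ennreal a * (\<integral>\<^sup>+r. ennreal ((a * r) ^ d * exp (- (a * r)\<^sup>2 / 2)) * indicator {0<..} (a * r) \<partial>lborel)"
    using nn_integral_real_affine[of "\<lambda>r. ennreal (r ^ d * exp (- r\<^sup>2 / 2)) * indicator {0<..} r" a 0] a
    by simp
  also have "\<dots> = ennreal a * (\<integral>\<^sup>+r. ennreal (a ^ d) * (ennreal (r ^ d * exp (- (r * a)\<^sup>2 / 2)) * indicator {0<..} r) \<partial>lborel)"
  proof (intro arg_cong[where f="\<lambda>x. ennreal a * x"] nn_integral_cong)
    fix r :: real
    show "ennreal ((a * r) ^ d * exp (- (a * r)\<^sup>2 / 2)) * indicator {0<..} (a * r)
      = ennreal (a ^ d) * (ennreal (r ^ d * exp (- (r * a)\<^sup>2 / 2)) * indicator {0<..} r)"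
    proof (cases "r > 0")
      case True
      then have "ennreal ((a * r) ^ d * exp (- (a * r)\<^sup>2 / 2)) = ennreal (a ^ d) * ennreal (r ^ d * exp (- (r * a)\<^sup>2 / 2))"
        using a by (simp only: power_mult_distrib mult.assoc mult.commute[of a r] flip: ennreal_mult')
          (simp add: ennreal_mult' mult.assoc mult.left_commute)
      then show ?thesis using True a by simp
    qed (use a in \<open>simp add: zero_less_mult_iff\<close>)
  qed
  also have "\<dots> = ennreal (a ^ (1 + d)) * ?I"
    using a by (subst nn_integral_cmult) (auto simp: ennreal_mult' mult.assoc)
  finally have "ennreal (inverse (a ^ (1 + d))) * ennreal ?K = ennreal (inverse (a ^ (1 + d))) * ennreal (a ^ (1 + d)) * ?I"
    by (simp only: mult.assoc)
  moreover have "ennreal (inverse (a ^ (1 + d))) * ennreal (a ^ (1 + d)) = 1"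
    using a by (simp flip: ennreal_mult' del: power_Suc)
  ultimately show ?thesis
    using a K by (simp only: ennreal_mult''[symmetric] mult_1 divide_inverse mult.commute)
qed

text \<open>
  Tonelli in place of a substitution: \<open>1 - exp (- w\<^sup>2 / 2)\<close> is the integral of the Rayleigh density
  \<open>y * exp (- y\<^sup>2 / 2)\<close> over \<open>y \<le> w\<close>. For \<open>w = a / r\<close> the region is \<open>r \<le> a / y\<close>, so integrating over
  \<open>r\<close> first contributes the factor \<open>a / y\<close>, which cancels the \<open>y\<close> of the density and leaves half a
  Gaussian integral.
\<close>
lemma nn_integral_one_minus_gaussian_inverse:
  assumes a: "a \<ge> 0"
  shows "(\<integral>\<^sup>+r. ennreal (1 - exp (- (a / r)\<^sup>2 / 2)) * indicator {0<..} r \<partial>lborel) = ennreal (a * sqrt (pi / 2))"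
proof -
  have FTC: "(\<integral>\<^sup>+y. ennreal (y * exp (- y\<^sup>2 / 2)) * indicator {0..w} y \<partial>lborel) = ennreal (1 - exp (- w\<^sup>2 / 2))"
    if "w \<ge> 0" for w :: real
  proof -
    have "(\<integral>\<^sup>+y. ennreal (y * exp (- y\<^sup>2 / 2)) * indicator {0..w} y \<partial>lborel)
      = ennreal ((\<lambda>y. - exp (- y\<^sup>2 / 2)) w - (\<lambda>y. - exp (- y\<^sup>2 / 2)) 0)"
      by (rule nn_integral_FTC_Icc) (use that in \<open>auto intro!: derivative_eq_intros\<close>)
    then show ?thesis by simp
  qed
  have half: "(\<integral>\<^sup>+y. ennreal (exp (- y\<^sup>2 / 2)) * indicator {0<..} y \<partial>lborel) = ennreal (sqrt (pi / 2))"
  proof -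
    have "2 powr (- (1 / 2)) * sqrt pi = sqrt (pi / 2)"
      by (simp add: powr_minus_divide powr_half_sqrt real_sqrt_divide)
    then show ?thesis
      using nn_integral_Gamma_gaussian[of 0] by (simp add: Gamma_one_half_real)
  qed
  have "(\<integral>\<^sup>+r. ennreal (1 - exp (- (a / r)\<^sup>2 / 2)) * indicator {0<..} r \<partial>lborel)
     = (\<integral>\<^sup>+r. (\<integral>\<^sup>+y. ennreal (y * exp (- y\<^sup>2 / 2)) * indicator {0..a/r} y * indicator {0<..} r \<partial>lborel) \<partial>lborel)"
  proof (intro nn_integral_cong)
    fix r :: real
    show "ennreal (1 - exp (- (a / r)\<^sup>2 / 2)) * indicator {0<..} r
      = (\<integral>\<^sup>+y. ennreal (y * exp (- y\<^sup>2 / 2)) * indicator {0..a/r} y * indicator {0<..} r \<partial>lborel)"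
      using a FTC[of "a / r"] by (cases "r > 0") simp_all
  qed
  also have "\<dots> = (\<integral>\<^sup>+r. (\<integral>\<^sup>+y. ennreal (y * exp (- y\<^sup>2 / 2)) * indicator {(r,y). 0 < r \<and> 0 < y \<and> r * y \<le> a} (r,y) \<partial>lborel) \<partial>lborel)"
    by (intro nn_integral_cong) (auto simp: indicator_def field_simps)
  also have "\<dots> = (\<integral>\<^sup>+y. (\<integral>\<^sup>+r. ennreal (y * exp (- y\<^sup>2 / 2)) * indicator {(r,y). 0 < r \<and> 0 < y \<and> r * y \<le> a} (r,y) \<partial>lborel) \<partial>lborel)"
  proof (rule lborel_pair.Fubini')
    have "{(r, y). 0 < r \<and> 0 < y \<and> r * y \<le> a} = {z \<in> space (borel \<Otimes>\<^sub>M borel). 0 < fst z \<and> 0 < snd z \<and> fst z * snd z \<le> a}"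
      by (auto simp: space_pair_measure)
    also have "\<dots> \<in> sets (borel \<Otimes>\<^sub>M borel)" by measurable
    finally have [measurable]: "{(r, y). 0 < r \<and> 0 < y \<and> r * y \<le> a} \<in> sets (borel \<Otimes>\<^sub>M borel)" .
    show "(\<lambda>(y,r). ennreal (y * exp (- y\<^sup>2 / 2)) * indicator {(r,y). 0 < r \<and> 0 < y \<and> r * y \<le> a} (r,y)) \<in> borel_measurable (lborel \<Otimes>\<^sub>M lborel)"
      by measurable
  qed
  also have "\<dots> = (\<integral>\<^sup>+y. ennreal a * (ennreal (exp (- y\<^sup>2 / 2)) * indicator {0<..} y) \<partial>lborel)"
  proof (intro nn_integral_cong)
    fix y :: real
    show "(\<integral>\<^sup>+r. ennreal (y * exp (- y\<^sup>2 / 2)) * indicator {(r,y). 0 < r \<and> 0 < y \<and> r * y \<le> a} (r,y) \<partial>lborel) =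
      ennreal a * (ennreal (exp (- y\<^sup>2 / 2)) * indicator {0<..} y)"
    proof (cases "y > 0")
      case True
      have "(\<integral>\<^sup>+r. ennreal (y * exp (- y\<^sup>2 / 2)) * indicator {(r,y). 0 < r \<and> 0 < y \<and> r * y \<le> a} (r,y) \<partial>lborel)
         = (\<integral>\<^sup>+r. ennreal (y * exp (- y\<^sup>2 / 2)) * indicator {0<..a/y} r \<partial>lborel)"
        using True by (intro nn_integral_cong) (auto simp: indicator_def field_simps)
      also have "\<dots> = ennreal (y * exp (- y\<^sup>2 / 2)) * ennreal (a / y)"
        using True a by (simp add: nn_integral_cmult)
      also have "\<dots> = ennreal (a * exp (- y\<^sup>2 / 2))"
        using True a by (simp flip: ennreal_mult')
      finally show ?thesis using True a by (simp add: ennreal_mult')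
    qed auto
  qed
  also have "\<dots> = ennreal (a * sqrt (pi / 2))"
    using a half by (subst nn_integral_cmult) (auto simp: ennreal_mult')
  finally show ?thesis .
qed

text \<open>
  Insert the Gaussian mixture for the weight, exchange the integrals, and evaluate the inner one by
  the Gaussian Fourier transform. The powers of \<open>r\<close> cancel, and the remaining one-dimensional
  integral is linear in \<open>norm x\<close>.
\<close>
lemma has_bochner_integral_one_minus_cos:
  fixes x :: "'a::euclidean_space"
  shows "has_bochner_integral lborel (\<lambda>t::'a. (1 - cos (t \<bullet> x)) / norm t ^ (1 + DIM('a)))
           (dcov_const DIM('a) * norm x)"
proof -
  let ?d = "DIM('a)"
  define K where "K = 2 powr ((real ?d - 1) / 2) * Gamma ((1 + real ?d) / 2)"
  let ?w = "\<lambda>r (t::'a). exp (- (r * norm t)\<^sup>2 / 2)"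
  let ?I = "\<integral>\<^sup>+t. ennreal ((1 - cos (t \<bullet> x)) / norm t ^ (1 + ?d)) \<partial>(lborel :: 'a measure)"
  have G: "Gamma ((1 + real ?d) / 2) > 0" by (intro Gamma_real_pos) simp
  then have K: "K > 0" by (simp add: K_def)
  have "ennreal K * ?I = (\<integral>\<^sup>+t. ennreal K * ennreal ((1 - cos (t \<bullet> x)) / norm t ^ (1 + ?d)) \<partial>(lborel :: 'a measure))"
    by (rule nn_integral_cmult[symmetric]) measurable
  also have "\<dots> = (\<integral>\<^sup>+t. (\<integral>\<^sup>+r. ennreal (1 - cos (t \<bullet> x)) * (ennreal (r ^ ?d * ?w r t) * indicator {0<..} r) \<partial>lborel) \<partial>lborel)"
  proof (rule nn_integral_cong_AE, use AE_lborel_singleton[of "0::'a"] in eventually_elim)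
    fix t :: 'a assume t: "t \<noteq> 0"
    have "(\<integral>\<^sup>+r. ennreal (1 - cos (t \<bullet> x)) * (ennreal (r ^ ?d * ?w r t) * indicator {0<..} r) \<partial>lborel)
      = ennreal (1 - cos (t \<bullet> x)) * ennreal (K / norm t ^ (1 + ?d))"
      using t nn_integral_gaussian_scale[of "norm t" ?d, folded K_def] by (subst nn_integral_cmult) auto
    also have "\<dots> = ennreal K * ennreal ((1 - cos (t \<bullet> x)) / norm t ^ (1 + ?d))"
      using K by (subst (1 2) ennreal_mult[symmetric]) (auto simp: mult_ac)
    finally show "ennreal K * ennreal ((1 - cos (t \<bullet> x)) / norm t ^ (1 + ?d)) =
      (\<integral>\<^sup>+r. ennreal (1 - cos (t \<bullet> x)) * (ennreal (r ^ ?d * ?w r t) * indicator {0<..} r) \<partial>lborel)" ..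
  qed
  also have "\<dots> = (\<integral>\<^sup>+r. (\<integral>\<^sup>+t. ennreal (1 - cos (t \<bullet> x)) * (ennreal (r ^ ?d * ?w r t) * indicator {0<..} r) \<partial>lborel) \<partial>lborel)"
    by (rule pair_sigma_finite.Fubini'[OF pair_sigma_finite.intro]) (unfold_locales, measurable)
  also have "\<dots> = (\<integral>\<^sup>+r. ennreal (sqrt (2 * pi) ^ ?d) * (ennreal (1 - exp (- (norm x / r)\<^sup>2 / 2)) * indicator {0<..} r) \<partial>lborel)"
  proof (intro nn_integral_cong)
    fix r :: real
    show "(\<integral>\<^sup>+t. ennreal (1 - cos (t \<bullet> x)) * (ennreal (r ^ ?d * ?w r t) * indicator {0<..} r) \<partial>lborel)
      = ennreal (sqrt (2 * pi) ^ ?d) * (ennreal (1 - exp (- (norm x / r)\<^sup>2 / 2)) * indicator {0<..} r)"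
    proof (cases "r > 0")
      case True
      have "(\<integral>\<^sup>+t. ennreal (1 - cos (t \<bullet> x)) * (ennreal (r ^ ?d * ?w r t) * indicator {0<..} r) \<partial>lborel)
        = (\<integral>\<^sup>+t. ennreal (r ^ ?d) * ennreal ((1 - cos (t \<bullet> x)) * ?w r t) \<partial>lborel)"
        using True by (intro nn_integral_cong) (simp add: ennreal_mult' mult_ac)
      also have "\<dots> = ennreal (r ^ ?d) * ennreal ((sqrt (2 * pi) / r) ^ ?d * (1 - exp (- (norm x / r)\<^sup>2 / 2)))"
        using nn_integral_one_minus_cos_gaussian[OF True, of x] by (subst nn_integral_cmult) auto
      also have "\<dots> = ennreal (sqrt (2 * pi) ^ ?d * (1 - exp (- (norm x / r)\<^sup>2 / 2)))"
        using True by (simp add: power_divide flip: ennreal_mult')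
      finally show ?thesis
        using True by (simp add: ennreal_mult')
    qed simp
  qed
  also have "\<dots> = ennreal (sqrt (2 * pi) ^ ?d) * ennreal (norm x * sqrt (pi / 2))"
    using nn_integral_one_minus_gaussian_inverse[of "norm x"] by (subst nn_integral_cmult) auto
  also have "\<dots> = ennreal ((sqrt (2 * pi) ^ ?d * sqrt (pi / 2)) * norm x)"
    by (simp add: mult_ac flip: ennreal_mult')
  also have "sqrt (2 * pi) ^ ?d * sqrt (pi / 2) = K * dcov_const ?d"
  proof -
    \<comment> \<open>Collecting the powers of 2 and of pi on both sides identifies the normalising constant.\<close>
    have "sqrt (2 * pi) ^ ?d * sqrt (pi / 2) = ((2 * pi) powr (1/2)) powr real ?d * (pi / 2) powr (1/2)"
      by (simp add: powr_half_sqrt powr_realpow)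
    also have "\<dots> = 2 powr (real ?d / 2 - 1 / 2) * pi powr (real ?d / 2 + 1 / 2)"
      by (simp add: powr_powr powr_mult powr_divide powr_diff powr_add)
    also have "\<dots> = 2 powr ((real ?d - 1) / 2) * pi powr ((1 + real ?d) / 2)"
      by (simp add: add_divide_distrib diff_divide_distrib add.commute)
    also have "\<dots> = K * dcov_const ?d"
      by (simp add: K_def dcov_const_def less_imp_neq[OF G, symmetric])
    finally show ?thesis .
  qed
  finally have "ennreal (inverse K) * ennreal K * ?I = ennreal (inverse K) * ennreal (K * dcov_const ?d * norm x)"
    by (simp only: mult.assoc)
  moreover have "ennreal (inverse K) * ennreal y = ennreal (inverse K * y)" for y
    by (rule ennreal_mult'[symmetric]) (use K in simp)
  moreover have "inverse K * K = 1" "inverse K * (K * dcov_const ?d * norm x) = dcov_const ?d * norm x"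
    using K by simp_all
  ultimately have "?I = ennreal (dcov_const ?d * norm x)"
    by (simp only: mult_1 ennreal_1)
  then show ?thesis
    using G by (intro has_bochner_integral_nn_integral) (auto simp: dcov_const_def)
qed

section \<open>The strong law of large numbers\<close>

text \<open>
  The running maximum of 0 and the first \<open>n\<close> partial sums of \<open>x\<close>. It is defined through the shifted
  sequence because that recursion is what the maximal inequality exploits.
\<close>

primrec running_max :: "nat \<Rightarrow> (nat \<Rightarrow> real) \<Rightarrow> real" where
  "running_max 0 x = 0"
| "running_max (Suc n) x = max 0 (x 0 + running_max n (\<lambda>k. x (Suc k)))"

lemma running_max_nonneg: "0 \<le> running_max n x"
  by (cases n) auto

lemma running_max_mono: "running_max n x \<le> running_max (Suc n) x"
proof (induction n arbitrary: x)
  case (Suc n)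
  have "max 0 (x 0 + running_max n (\<lambda>k. x (Suc k))) \<le> max 0 (x 0 + running_max (Suc n) (\<lambda>k. x (Suc k)))"
    by (intro max.mono order_refl add_left_mono Suc.IH)
  then show ?case
    by (simp only: running_max.simps(2)[of n x] running_max.simps(2)[of "Suc n" x])
qed simp

lemma incseq_running_max: "incseq (\<lambda>n. running_max n x)"
  by (rule incseq_SucI) (rule running_max_mono)

lemma partial_sum_le_running_max: "(\<Sum>k<n. x k) \<le> running_max n x"
proof (induction n arbitrary: x)
  case (Suc n)
  have "(\<Sum>k<Suc n. x k) = x 0 + (\<Sum>k<n. x (Suc k))"
    by (rule sum.lessThan_Suc_shift)
  also have "\<dots> \<le> x 0 + running_max n (\<lambda>k. x (Suc k))"
    using Suc.IH by simp
  finally show ?case by simp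
qed simp

text \<open>
  Prepending an element shifts all partial sums by a constant, so boundedness is a shift-invariant
  event.
\<close>
lemma bdd_above_running_max_case_nat:
  "bdd_above (range (\<lambda>n. running_max n (case_nat x y))) \<longleftrightarrow> bdd_above (range (\<lambda>n. running_max n y))"
proof
  assume "bdd_above (range (\<lambda>n. running_max n (case_nat x y)))"
  then obtain B where B: "\<And>n. running_max n (case_nat x y) \<le> B"
    by (auto simp: bdd_above_def)
  have "running_max n y \<le> B - x" for n
    using B[of "Suc n"] by simp
  then show "bdd_above (range (\<lambda>n. running_max n y))" by (rule bdd_aboveI2)
next
  assume "bdd_above (range (\<lambda>n. running_max n y))"
  then obtain B where B: "\<And>n. running_max n y \<le> B"
    by (auto simp: bdd_above_def)
  have "running_max n (case_nat x y) \<le> max 0 (x + B)" for n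
    using B[of "n - 1"] by (cases n) (auto simp: le_max_iff_disj)
  then show "bdd_above (range (\<lambda>n. running_max n (case_nat x y)))" by (rule bdd_aboveI2)
qed

text \<open>
  Write \<open>S\<close> for the law of the sequence and \<open>M\<^sub>n\<close> for its running maxima, and let \<open>A\<close> be the event
  that they are unbounded. The sequence obtained by prepending an independent copy of the first
  variable \<open>x\<close> is distributed as \<open>S\<close>, its running maximum of index \<open>n + 1\<close> is \<open>max 0 (x + M\<^sub>n)\<close>, and
  \<open>A\<close> is not affected. Comparing expectations on \<open>A\<close> and using that \<open>M\<^sub>n\<close> increases with \<open>n\<close> shows that
  \<open>max (- M\<^sub>n) x\<close> has nonnegative integral over \<open>A\<close>. On \<open>A\<close> the maxima tend to infinity, so
  in the limit the integral of \<open>x\<close> over \<open>A\<close> is nonnegative. As \<open>A\<close> depends on the rest of the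
  sequence only, this integral is the mean times the probability of \<open>A\<close>. A negative mean therefore
  forces \<open>A\<close> to be null.
\<close>
lemma AE_bounded_running_max:
  fixes D :: "real measure"
  assumes D: "prob_space D" and sets_D[measurable_cong]: "sets D = sets borel"
    and int_D: "integrable D (\<lambda>x. x)" and neg: "(\<integral>x. x \<partial>D) < 0"
  shows "AE x in (\<Pi>\<^sub>M k\<in>(UNIV :: nat set). D). bdd_above (range (\<lambda>n. running_max n x))"
proof -
  interpret D: prob_space D by (rule D)
  interpret S: prob_space "\<Pi>\<^sub>M k\<in>(UNIV :: nat set). D" by (rule prob_space_PiM) (rule D)
  interpret sequence_space D ..
  interpret DS: pair_prob_space D S ..
  have coord[measurable]: "(\<lambda>x. x k) \<in> borel_measurable S" for k :: nat
  proof -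
    have "(\<lambda>x. x k) \<in> S \<rightarrow>\<^sub>M D" by (rule measurable_component_singleton) simp
    then show ?thesis by (simp only: measurable_cong_sets[OF refl sets_D])
  qed
  have shift: "(\<lambda>x k. x (Suc k)) \<in> S \<rightarrow>\<^sub>M S"
  proof (rule measurable_PiM_single')
    show "(\<lambda>x. x (Suc k)) \<in> S \<rightarrow>\<^sub>M D" for k
      by (rule measurable_component_singleton) simp
    show "(\<lambda>x k. x (Suc k)) \<in> space S \<rightarrow> (\<Pi>\<^sub>E k\<in>UNIV. space D)"
      by (simp add: space_PiM PiE_UNIV_domain Pi_iff)
  qed
  have meas[measurable]: "running_max n \<in> borel_measurable S" for n
  proof (induction n)
    case (Suc n)
    have "running_max (Suc n) = (\<lambda>x. max 0 (x 0 + running_max n (\<lambda>k. x (Suc k))))"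
      by (simp add: fun_eq_iff)
    with coord[of 0] measurable_compose[OF shift Suc.IH] show ?case
      by (simp only: borel_measurable_max borel_measurable_add borel_measurable_const)
  qed simp
  have iter[measurable]: "(\<lambda>(s, \<omega>). case_nat s \<omega>) \<in> D \<Otimes>\<^sub>M S \<rightarrow>\<^sub>M S"
    by measurable
  have id_D[measurable]: "(\<lambda>x. x) \<in> borel_measurable D"
    using int_D by (rule borel_measurable_integrable)
  have fst_meas[measurable]: "fst \<in> borel_measurable (D \<Otimes>\<^sub>M S)"
    using measurable_compose[OF measurable_fst id_D] by simp
  have x_int: "integrable (D \<Otimes>\<^sub>M S) (\<lambda>z. fst z)"
  proof -
    have "distr (D \<Otimes>\<^sub>M S) D fst = D" by (rule S.distr_pair_fst)
    then have "integrable (distr (D \<Otimes>\<^sub>M S) D fst) (\<lambda>x. x)"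
      using int_D by simp
    then show ?thesis
      by (subst (asm) integrable_distr_eq) (auto intro: id_D)
  qed
  have snd_int: "integrable (D \<Otimes>\<^sub>M S) (\<lambda>z. f (snd z)) \<longleftrightarrow> integrable S f"
    "(\<integral>z. f (snd z) \<partial>(D \<Otimes>\<^sub>M S)) = integral\<^sup>L S f"
    if "f \<in> borel_measurable S" for f :: "(nat \<Rightarrow> real) \<Rightarrow> real"
  proof -
    have eq: "distr (D \<Otimes>\<^sub>M S) S snd = S"
    proof (rule measure_eqI)
      fix B assume B: "B \<in> sets (distr (D \<Otimes>\<^sub>M S) S snd)"
      then have "snd -` B \<inter> space (D \<Otimes>\<^sub>M S) = space D \<times> B"
        using sets.sets_into_space[of B S] by (auto simp: space_pair_measure)
      then show "emeasure (distr (D \<Otimes>\<^sub>M S) S snd) B = emeasure S B"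
        using B by (simp add: emeasure_distr S.emeasure_pair_measure_Times D.emeasure_space_1)
    qed simp
    show "integrable (D \<Otimes>\<^sub>M S) (\<lambda>z. f (snd z)) \<longleftrightarrow> integrable S f"
      using integrable_distr_eq[OF measurable_snd that, of D] unfolding eq by (rule sym)
    show "(\<integral>z. f (snd z) \<partial>(D \<Otimes>\<^sub>M S)) = integral\<^sup>L S f"
      using integral_distr[OF measurable_snd that, of D] unfolding eq by (rule sym)
  qed
  have iter_int: "integrable (D \<Otimes>\<^sub>M S) (\<lambda>z. f (case_nat (fst z) (snd z))) \<longleftrightarrow> integrable S f"
    "(\<integral>z. f (case_nat (fst z) (snd z)) \<partial>(D \<Otimes>\<^sub>M S)) = integral\<^sup>L S f"
    if "f \<in> borel_measurable S" for f :: "(nat \<Rightarrow> real) \<Rightarrow> real"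
    using integrable_distr_eq[OF iter that, symmetric] integral_distr[OF iter that, symmetric]
    unfolding PiM_iter by (simp_all only: case_prod_beta')
  \<comment> \<open>Integrability also propagates along the recursion, through the equality of laws.\<close>
  have rm_int: "integrable S (running_max n)" for n
  proof (induction n)
    case (Suc n)
    have "integrable (D \<Otimes>\<^sub>M S) (\<lambda>z. max 0 (fst z + running_max n (snd z)))"
      using x_int snd_int(1)[of "running_max n"] Suc.IH by auto
    then show ?case
      by (subst iter_int(1)[symmetric]) auto
  qed simp
  define A where "A = {x \<in> space S. \<not> bdd_above (range (\<lambda>n. running_max n x))}"
  have A[measurable]: "A \<in> sets S"
  proof -
    have "A = {x \<in> space S. \<forall>m::nat. \<exists>n. real m < running_max n x}"
      unfolding A_def bdd_above_def
      by (auto simp: not_le) (meson le_less_trans less_le_trans not_le real_arch_simple order.strict_trans2)+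
    also have "\<dots> \<in> sets S" by measurable
    finally show ?thesis .
  qed
  have A_inv: "indicator A (case_nat x y) = (indicator A y :: real)" if "(x, y) \<in> space (D \<Otimes>\<^sub>M S)" for x y
    using that measurable_space[OF iter that]
    by (auto simp: indicator_def A_def bdd_above_running_max_case_nat space_pair_measure)
  have ind_int: "integrable S (\<lambda>x. running_max n x * indicator A x)" for n
    using integrable_mult_indicator[OF A rm_int[of n]] by (simp add: mult.commute)
  let ?g = "\<lambda>n z. max (- running_max n (snd z)) (fst z) * indicator A (snd z)"
  \<comment> \<open>The maximal inequality: \<open>?g n z\<close> is the increment from \<open>M\<^sub>n\<close> to \<open>max 0 (x + M\<^sub>n)\<close> on \<open>A\<close>.\<close>
  have nonneg: "0 \<le> (\<integral>z. ?g n z \<partial>(D \<Otimes>\<^sub>M S))" for n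
  proof -
    have "(\<integral>x. running_max n x * indicator A x \<partial>S) \<le> (\<integral>x. running_max (Suc n) x * indicator A x \<partial>S)"
      by (intro integral_mono ind_int mult_right_mono running_max_mono) auto
    also have "\<dots> = (\<integral>z. running_max (Suc n) (case_nat (fst z) (snd z)) * indicator A (case_nat (fst z) (snd z)) \<partial>(D \<Otimes>\<^sub>M S))"
      by (rule iter_int(2)[of "\<lambda>x. running_max (Suc n) x * indicator A x", symmetric])
         (intro borel_measurable_times meas borel_measurable_indicator A)
    also have "\<dots> = (\<integral>z. ?g n z + running_max n (snd z) * indicator A (snd z) \<partial>(D \<Otimes>\<^sub>M S))"
      by (intro Bochner_Integration.integral_cong refl)
         (clarsimp simp: A_inv, auto simp: max_def indicator_def)
    also have "\<dots> = (\<integral>z. ?g n z \<partial>(D \<Otimes>\<^sub>M S)) + (\<integral>z. running_max n (snd z) * indicator A (snd z) \<partial>(D \<Otimes>\<^sub>M S))"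
    proof (rule Bochner_Integration.integral_add)
      show "integrable (D \<Otimes>\<^sub>M S) (\<lambda>z. running_max n (snd z) * indicator A (snd z))"
        using snd_int(1)[of "\<lambda>x. running_max n x * indicator A x"] ind_int by simp
      have "integrable (D \<Otimes>\<^sub>M S) (\<lambda>z. indicator {z \<in> space (D \<Otimes>\<^sub>M S). snd z \<in> A} z *\<^sub>R max (- running_max n (snd z)) (fst z))"
        by (rule integrable_mult_indicator) (use x_int snd_int(1)[of "running_max n"] rm_int in auto)
      then show "integrable (D \<Otimes>\<^sub>M S) (?g n)"
        by (rule Bochner_Integration.integrable_cong[THEN iffD1, rotated 2]) (auto simp: indicator_def)
    qed
    also have "(\<integral>z. running_max n (snd z) * indicator A (snd z) \<partial>(D \<Otimes>\<^sub>M S)) = (\<integral>x. running_max n x * indicator A x \<partial>S)"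
      by (rule snd_int(2)) measurable
    finally show ?thesis by simp
  qed
  have lim: "(\<lambda>n. \<integral>z. ?g n z \<partial>(D \<Otimes>\<^sub>M S)) \<longlonglongrightarrow> (\<integral>z. fst z * indicator A (snd z) \<partial>(D \<Otimes>\<^sub>M S))"
  proof (rule integral_dominated_convergence[where w="\<lambda>z. \<bar>fst z\<bar>"])
    show "AE z in D \<Otimes>\<^sub>M S. (\<lambda>n. ?g n z) \<longlonglongrightarrow> fst z * indicator A (snd z)"
    proof (rule AE_I2)
      fix z :: "real \<times> (nat \<Rightarrow> real)"
      show "(\<lambda>n. ?g n z) \<longlonglongrightarrow> fst z * indicator A (snd z)"
      proof (cases "snd z \<in> A")
        case True
        then obtain m where m: "- fst z < running_max m (snd z)"
          by (force simp: A_def bdd_above_def not_le)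
        have "?g n z = fst z * indicator A (snd z)" if "n \<ge> m" for n
          using incseqD[OF incseq_running_max that, of "snd z"] m by (simp add: max_def)
        then show ?thesis
          by (intro tendsto_eventually eventually_sequentiallyI[of m])
      qed simp
    qed
    show "AE z in D \<Otimes>\<^sub>M S. norm (?g n z) \<le> \<bar>fst z\<bar>" for n
    proof (rule AE_I2)
      fix z :: "real \<times> (nat \<Rightarrow> real)"
      show "norm (?g n z) \<le> \<bar>fst z\<bar>"
        using running_max_nonneg[of n "snd z"] by (simp add: indicator_def max_def abs_if)
    qed
  qed (use x_int in auto)
  have "0 \<le> (\<integral>z. fst z * indicator A (snd z) \<partial>(D \<Otimes>\<^sub>M S))"
    by (rule LIMSEQ_le_const[OF lim]) (use nonneg in blast)
  also have "\<dots> = (\<integral>x. x \<partial>D) * measure S A"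
  proof -
    have i: "integrable (D \<Otimes>\<^sub>M S) (\<lambda>z. fst z * indicator A (snd z))"
      by (rule Bochner_Integration.integrable_bound[OF x_int]) (auto simp: indicator_def)
    have "(\<integral>z. fst z * indicator A (snd z) \<partial>(D \<Otimes>\<^sub>M S)) = (\<integral>x. \<integral>y. x * indicator A y \<partial>S \<partial>D)"
      using DS.integral_fst'[OF i] by simp
    also have "\<dots> = (\<integral>x. x \<partial>D) * measure S A" by simp
    finally show ?thesis .
  qed
  finally have "measure S A = 0"
    using neg by (metis measure_nonneg mult_neg_pos not_less order_le_less)
  then have "A \<in> null_sets S" using A by (simp add: S.emeasure_eq_measure null_setsI)
  then show ?thesis by (rule AE_I') (auto simp: A_def)
qed

context prob_space
begin

lemma AE_partial_sums_bounded_above: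
  fixes X :: "nat \<Rightarrow> 'a \<Rightarrow> real"
  assumes ind: "indep_vars (\<lambda>_. borel) X UNIV"
    and id: "\<And>k. distr M borel (X k) = distr M borel (X 0)"
    and int: "integrable M (X 0)" and neg: "expectation (X 0) < 0"
  shows "AE \<omega> in M. \<exists>B. \<forall>n. (\<Sum>k<n. X k \<omega>) \<le> B"
proof -
  have rv[measurable]: "X k \<in> borel_measurable M" for k
    using ind by (auto simp: indep_vars_def)
  let ?D = "distr M borel (X 0)" and ?X = "\<lambda>\<omega> k. X k \<omega>"
  have "distr M (\<Pi>\<^sub>M k\<in>UNIV. borel) (\<lambda>\<omega>. \<lambda>k\<in>UNIV. X k \<omega>) = (\<Pi>\<^sub>M k\<in>UNIV. distr M borel (X k))"
    using ind by (subst (asm) indep_vars_iff_distr_eq_PiM') auto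
  also have "\<dots> = (\<Pi>\<^sub>M k\<in>UNIV. ?D)" by (intro PiM_cong refl id)
  finally have eq: "distr M (\<Pi>\<^sub>M k\<in>UNIV. borel) ?X = (\<Pi>\<^sub>M k\<in>UNIV. ?D)"
    unfolding restrict_UNIV .
  have "AE x in (\<Pi>\<^sub>M k\<in>(UNIV :: nat set). ?D). bdd_above (range (\<lambda>n. running_max n x))"
    by (rule AE_bounded_running_max) (use int neg in \<open>auto simp: prob_space_distr integrable_distr_eq integral_distr\<close>)
  then have "AE \<omega> in M. bdd_above (range (\<lambda>n. running_max n (?X \<omega>)))"
    unfolding eq[symmetric]
    by (rule AE_distrD[rotated]) (rule measurable_PiM_single', auto)
  then show ?thesis
  proof eventually_elim
    case (elim \<omega>)
    then obtain B where "\<And>n. running_max n (?X \<omega>) \<le> B" by (auto simp: bdd_above_def)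
    with partial_sum_le_running_max[of "?X \<omega>"] show ?case
      by (meson order_trans)
  qed
qed

text \<open>
  Subtracting a constant strictly between the mean and \<open>c\<close> makes the mean negative; the centred
  partial sums are then bounded above, and the bound disappears after division by \<open>n\<close>.
\<close>
lemma AE_average_less:
  fixes X :: "nat \<Rightarrow> 'a \<Rightarrow> real"
  assumes ind: "indep_vars (\<lambda>_. borel) X UNIV"
    and id: "\<And>k. distr M borel (X k) = distr M borel (X 0)"
    and int: "integrable M (X 0)" and c: "expectation (X 0) < c"
  shows "AE \<omega> in M. \<forall>\<^sub>F n in sequentially. (\<Sum>k<n. X k \<omega>) / real n < c"
proof -
  obtain c' where c': "expectation (X 0) < c'" "c' < c" using dense[OF c] by blast
  have rv[measurable]: "X k \<in> borel_measurable M" for k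
    using ind by (auto simp: indep_vars_def)
  have "AE \<omega> in M. \<exists>B. \<forall>n. (\<Sum>k<n. X k \<omega> - c') \<le> B"
  proof (rule AE_partial_sums_bounded_above)
    show "indep_vars (\<lambda>_. borel) (\<lambda>k \<omega>. X k \<omega> - c') UNIV"
      using indep_vars_compose2[OF ind, of "\<lambda>_ x. x - c'" "\<lambda>_. borel"] by simp
    have *: "distr M borel (\<lambda>\<omega>. X k \<omega> - c') = distr (distr M borel (X k)) borel (\<lambda>x. x - c')" for k
      by (simp add: distr_distr comp_def)
    show "distr M borel (\<lambda>\<omega>. X k \<omega> - c') = distr M borel (\<lambda>\<omega>. X 0 \<omega> - c')" for k
      unfolding * by (simp only: id[of k])
  qed (use int c' in \<open>auto simp: prob_space\<close>)
  then show ?thesis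
  proof eventually_elim
    case (elim \<omega>)
    then obtain B where B: "\<And>n. (\<Sum>k<n. X k \<omega>) - real n * c' \<le> B" by (auto simp: sum_subtractf)
    have "\<forall>\<^sub>F n in sequentially. B / (c - c') < real n"
      using filterlim_real_sequentially by (simp add: filterlim_at_top_dense)
    then show ?case
      using eventually_gt_at_top[of 0]
    proof eventually_elim
      case (elim n)
      then have "B < real n * (c - c')" using c' by (simp add: pos_divide_less_eq)
      with B[of n] have "(\<Sum>k<n. X k \<omega>) < real n * c" by (simp add: algebra_simps)
      then show ?case using elim by (simp add: divide_less_eq mult.commute)
    qed
  qed
qed

text \<open>
  The one-sided bound, applied to the variables and to their negatives.
\<close>
lemma strong_law_of_large_numbers:
  fixes X :: "nat \<Rightarrow> 'a \<Rightarrow> real"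
  assumes ind: "indep_vars (\<lambda>_. borel) X UNIV"
    and id: "\<And>k. distr M borel (X k) = distr M borel (X 0)"
    and int: "integrable M (X 0)"
  shows "AE \<omega> in M. (\<lambda>n. (\<Sum>k<n. X k \<omega>) / real n) \<longlonglongrightarrow> expectation (X 0)"
proof -
  let ?\<mu> = "expectation (X 0)"
  have rv[measurable]: "X k \<in> borel_measurable M" for k
    using ind by (auto simp: indep_vars_def)
  have up: "AE \<omega> in M. \<forall>m. \<forall>\<^sub>F n in sequentially. (\<Sum>k<n. X k \<omega>) / real n < ?\<mu> + inverse (Suc m)"
    unfolding AE_all_countable by (intro allI AE_average_less ind id int) simp
  have ind': "indep_vars (\<lambda>_. borel) (\<lambda>k \<omega>. - X k \<omega>) UNIV"
    using indep_vars_compose2[OF ind, of "\<lambda>_ x. - x" "\<lambda>_. borel"] by simp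
  have *: "distr M borel (\<lambda>\<omega>. - X k \<omega>) = distr (distr M borel (X k)) borel uminus" for k
    by (simp add: distr_distr comp_def)
  have id': "distr M borel (\<lambda>\<omega>. - X k \<omega>) = distr M borel (\<lambda>\<omega>. - X 0 \<omega>)" for k
    unfolding * by (simp only: id[of k])
  have low: "AE \<omega> in M. \<forall>m. \<forall>\<^sub>F n in sequentially. (\<Sum>k<n. - X k \<omega>) / real n < - ?\<mu> + inverse (Suc m)"
    unfolding AE_all_countable by (intro allI AE_average_less ind' id') (use int in auto)
  from up low show ?thesis
  proof eventually_elim
    case (elim \<omega>)
    show ?case
    proof (rule LIMSEQ_I)
      fix r :: real assume "0 < r"
      then obtain m where m: "inverse (Suc m) < r" using reals_Archimedean by blast
      have "\<forall>\<^sub>F n in sequentially. norm ((\<Sum>k<n. X k \<omega>) / real n - ?\<mu>) < r"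
        using elim(1)[THEN spec, of m] elim(2)[THEN spec, of m]
        by eventually_elim (use m in \<open>auto simp: sum_negf abs_if\<close>)
      then show "\<exists>no. \<forall>n\<ge>no. norm ((\<Sum>k<n. X k \<omega>) / real n - ?\<mu>) < r"
        by (simp add: eventually_sequentially)
    qed
  qed
qed

text \<open>
  Functions of independent identically distributed elements of an arbitrary measurable space, for
  use with the norms and the characters of the sample.
\<close>
lemma strong_law_of_large_numbers_complex:
  fixes Z :: "nat \<Rightarrow> 'a \<Rightarrow> 'b" and f :: "'b \<Rightarrow> complex"
  assumes ind: "indep_vars (\<lambda>_. N) Z UNIV"
    and id: "\<And>k. distr M N (Z k) = distr M N W"
    and W[measurable]: "W \<in> M \<rightarrow>\<^sub>M N" and f[measurable]: "f \<in> borel_measurable N"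
    and int: "integrable M (\<lambda>\<omega>. f (W \<omega>))"
  shows "AE \<omega> in M. (\<lambda>n. (\<Sum>k<n. f (Z k \<omega>)) / of_nat n) \<longlonglongrightarrow> expectation (\<lambda>\<omega>. f (W \<omega>))"
proof -
  have rv[measurable]: "Z k \<in> M \<rightarrow>\<^sub>M N" for k
    using ind by (auto simp: indep_vars_def)
  have real: "AE \<omega> in M. (\<lambda>n. (\<Sum>k<n. g (Z k \<omega>)) / real n) \<longlonglongrightarrow> expectation (\<lambda>\<omega>. g (W \<omega>))"
    if g[measurable]: "g \<in> borel_measurable N" and gi: "integrable M (\<lambda>\<omega>. g (W \<omega>))" for g :: "'b \<Rightarrow> real"
  proof -
    have d: "distr M borel (\<lambda>\<omega>. g (Z k \<omega>)) = distr (distr M N W) borel g" for k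
      by (simp add: distr_distr comp_def flip: id[of k])
    have e: "integrable M (\<lambda>\<omega>. g (Z 0 \<omega>))" "expectation (\<lambda>\<omega>. g (Z 0 \<omega>)) = expectation (\<lambda>\<omega>. g (W \<omega>))"
      using gi integrable_distr_eq[of "Z 0" M N g] integrable_distr_eq[of W M N g]
        integral_distr[of "Z 0" M N g] integral_distr[of W M N g] by (simp_all add: id)
    have "AE \<omega> in M. (\<lambda>n. (\<Sum>k<n. g (Z k \<omega>)) / real n) \<longlonglongrightarrow> expectation (\<lambda>\<omega>. g (Z 0 \<omega>))"
      by (rule strong_law_of_large_numbers)
         (use indep_vars_compose2[OF ind, of "\<lambda>_. g" "\<lambda>_. borel"] e in \<open>auto simp: d\<close>)
    then show ?thesis by (simp only: e)
  qed
  have "AE \<omega> in M. (\<lambda>n. (\<Sum>k<n. Re (f (Z k \<omega>))) / real n) \<longlonglongrightarrow> expectation (\<lambda>\<omega>. Re (f (W \<omega>)))"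
    by (rule real) (use int in auto)
  moreover have "AE \<omega> in M. (\<lambda>n. (\<Sum>k<n. Im (f (Z k \<omega>))) / real n) \<longlonglongrightarrow> expectation (\<lambda>\<omega>. Im (f (W \<omega>)))"
    by (rule real) (use int in auto)
  ultimately show ?thesis
  proof eventually_elim
    case (elim \<omega>)
    then show ?case
      by (intro tendsto_complex_iff[THEN iffD2]) (use int in simp)
  qed
qed

end

section \<open>Dominated convergence with varying majorants\<close>

text \<open>
  Truncating by the limiting majorant \<open>g\<close> reduces this to ordinary dominated convergence, applied to
  \<open>min (hs n) g\<close> and to \<open>min (gs n) g\<close>. The excess of \<open>hs n\<close> over \<open>g\<close> is at most that of \<open>gs n\<close>,
  whose integral tends to 0 because the integrals of \<open>gs n\<close> converge to that of \<open>g\<close>.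
\<close>

lemma tendsto_integral_dominated_by_convergent:
  fixes h :: "'a \<Rightarrow> real"
  assumes [measurable]: "\<And>n. hs n \<in> borel_measurable M" "h \<in> borel_measurable M"
    and gs: "\<And>n. integrable M (gs n)" and g: "integrable M g"
    and h_lim: "AE x in M. (\<lambda>n. hs n x) \<longlonglongrightarrow> h x" and g_lim: "AE x in M. (\<lambda>n. gs n x) \<longlonglongrightarrow> g x"
    and bound: "\<And>n x. 0 \<le> hs n x" "\<And>n x. hs n x \<le> gs n x" "\<And>x. 0 \<le> h x" "\<And>x. h x \<le> g x"
    and int_lim: "(\<lambda>n. \<integral>x. gs n x \<partial>M) \<longlonglongrightarrow> (\<integral>x. g x \<partial>M)"
  shows "(\<lambda>n. \<integral>x. hs n x \<partial>M) \<longlonglongrightarrow> (\<integral>x. h x \<partial>M)"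
proof -
  have [measurable]: "gs n \<in> borel_measurable M" "g \<in> borel_measurable M" for n
    using gs g by auto
  have pos: "0 \<le> gs n x" "0 \<le> g x" for n x
    using bound order_trans by blast+
  have hs: "integrable M (hs n)" for n
    by (rule Bochner_Integration.integrable_bound[OF gs[of n]]) (use bound pos in auto)
  have min_h: "(\<lambda>n. \<integral>x. min (hs n x) (g x) \<partial>M) \<longlonglongrightarrow> (\<integral>x. h x \<partial>M)"
  proof (rule integral_dominated_convergence[OF _ _ g])
    show "AE x in M. (\<lambda>n. min (hs n x) (g x)) \<longlonglongrightarrow> h x"
      using h_lim
    proof eventually_elim
      case (elim x)
      from tendsto_min[OF this tendsto_const[of "g x"]] show ?case
        using bound(4)[of x] by (simp add: min_absorb1)
    qed
  qed (use bound pos in \<open>auto simp: min_def\<close>)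
  have min_g: "(\<lambda>n. \<integral>x. min (gs n x) (g x) \<partial>M) \<longlonglongrightarrow> (\<integral>x. g x \<partial>M)"
  proof (rule integral_dominated_convergence[OF _ _ g])
    show "AE x in M. (\<lambda>n. min (gs n x) (g x)) \<longlonglongrightarrow> g x"
      using g_lim
    proof eventually_elim
      case (elim x)
      from tendsto_min[OF this tendsto_const[of "g x"]] show ?case by simp
    qed
  qed (use pos in \<open>auto simp: min_def\<close>)
  have rest: "(\<lambda>n. \<integral>x. hs n x - min (hs n x) (g x) \<partial>M) \<longlonglongrightarrow> 0"
  proof (rule tendsto_sandwich[OF _ _ tendsto_const])
    show "(\<lambda>n. (\<integral>x. gs n x \<partial>M) - (\<integral>x. min (gs n x) (g x) \<partial>M)) \<longlonglongrightarrow> 0"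
      using tendsto_diff[OF int_lim min_g] by simp
    show "\<forall>\<^sub>F n in sequentially. 0 \<le> (\<integral>x. hs n x - min (hs n x) (g x) \<partial>M)"
      by (intro always_eventually allI integral_nonneg) simp
    have "(\<integral>x. hs n x - min (hs n x) (g x) \<partial>M) \<le> (\<integral>x. gs n x - min (gs n x) (g x) \<partial>M)" for n
    proof (rule integral_mono)
      show "hs n x - min (hs n x) (g x) \<le> gs n x - min (gs n x) (g x)" for x
        using bound(2)[of n x] by (auto simp: min_def)
    qed (use gs hs g in auto)
    also have "\<And>n. (\<integral>x. gs n x - min (gs n x) (g x) \<partial>M) = (\<integral>x. gs n x \<partial>M) - (\<integral>x. min (gs n x) (g x) \<partial>M)"
      by (rule Bochner_Integration.integral_diff) (use gs g in auto)
    finally show "\<forall>\<^sub>F n in sequentially. (\<integral>x. hs n x - min (hs n x) (g x) \<partial>M)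
        \<le> (\<integral>x. gs n x \<partial>M) - (\<integral>x. min (gs n x) (g x) \<partial>M)"
      by (intro always_eventually allI)
  qed
  have "(\<integral>x. hs n x - min (hs n x) (g x) \<partial>M) + (\<integral>x. min (hs n x) (g x) \<partial>M) = (\<integral>x. hs n x \<partial>M)" for n
    using hs g by simp
  with tendsto_add[OF rest min_h] show ?thesis by simp
qed

section \<open>Characteristic functions\<close>

text \<open>
  By nonnegativity of the quadratic polynomial in \<open>s\<close> given by the second moment of
  \<open>s * cmod U - cmod V\<close>.
\<close>

lemma (in prob_space) cauchy_schwarz_expectation:
  fixes U V :: "'a \<Rightarrow> complex"
  assumes [measurable]: "U \<in> borel_measurable M" "V \<in> borel_measurable M"
    and U: "integrable M (\<lambda>\<omega>. (cmod (U \<omega>))\<^sup>2)" and V: "integrable M (\<lambda>\<omega>. (cmod (V \<omega>))\<^sup>2)"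
  shows "(cmod (expectation (\<lambda>\<omega>. U \<omega> * V \<omega>)))\<^sup>2
      \<le> expectation (\<lambda>\<omega>. (cmod (U \<omega>))\<^sup>2) * expectation (\<lambda>\<omega>. (cmod (V \<omega>))\<^sup>2)"
proof -
  define a where "a = expectation (\<lambda>\<omega>. (cmod (U \<omega>))\<^sup>2)"
  define b where "b = expectation (\<lambda>\<omega>. (cmod (V \<omega>))\<^sup>2)"
  define c where "c = expectation (\<lambda>\<omega>. cmod (U \<omega>) * cmod (V \<omega>))"
  have ab: "a \<ge> 0" "b \<ge> 0" by (simp_all add: a_def b_def)
  have UV: "integrable M (\<lambda>\<omega>. cmod (U \<omega>) * cmod (V \<omega>))"
  proof (rule Bochner_Integration.integrable_bound)
    show "integrable M (\<lambda>\<omega>. (cmod (U \<omega>))\<^sup>2 + (cmod (V \<omega>))\<^sup>2)"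
      using U V by simp
    show "AE \<omega> in M. norm (cmod (U \<omega>) * cmod (V \<omega>)) \<le> norm ((cmod (U \<omega>))\<^sup>2 + (cmod (V \<omega>))\<^sup>2)"
    proof (rule AE_I2)
      fix \<omega>
      have "0 \<le> (cmod (U \<omega>) - cmod (V \<omega>))\<^sup>2 + (cmod (U \<omega>))\<^sup>2 + (cmod (V \<omega>))\<^sup>2" by simp
      then show "norm (cmod (U \<omega>) * cmod (V \<omega>)) \<le> norm ((cmod (U \<omega>))\<^sup>2 + (cmod (V \<omega>))\<^sup>2)"
        by (simp add: power2_diff abs_mult)
    qed
  qed measurable
  have c: "c \<ge> 0" by (simp add: c_def)
  have quad: "0 \<le> s\<^sup>2 * a - 2 * s * c + b" for s
  proof -
    have "0 \<le> expectation (\<lambda>\<omega>. (s * cmod (U \<omega>) - cmod (V \<omega>))\<^sup>2)" by simp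
    also have "\<dots> = expectation (\<lambda>\<omega>. s\<^sup>2 * (cmod (U \<omega>))\<^sup>2 - 2 * s * (cmod (U \<omega>) * cmod (V \<omega>)) + (cmod (V \<omega>))\<^sup>2)"
      by (simp add: power2_diff power_mult_distrib mult.assoc add_diff_eq[symmetric] diff_add_eq)
    also have "\<dots> = s\<^sup>2 * a - 2 * s * c + b"
      using U V UV by (simp add: a_def b_def c_def)
    finally show ?thesis .
  qed
  have "c\<^sup>2 \<le> a * b"
  proof (cases "a = 0")
    case True
    have "c = 0"
    proof (rule ccontr)
      assume "c \<noteq> 0"
      \<comment> \<open>If \<open>a = 0\<close> the polynomial is affine in \<open>s\<close>; at this \<open>s\<close> it takes the value -1 unless \<open>c = 0\<close>.\<close>
      then have "2 * ((b + 1) / (2 * c)) * c = b + 1" by simp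
      then show False using quad[of "(b + 1) / (2 * c)"] True by simp
    qed
    then show ?thesis using ab by simp
  next
    case False
    then have a: "a > 0" using ab by simp
    have "(c / a)\<^sup>2 * a - 2 * (c / a) * c + b = b - c\<^sup>2 / a"
      using a by (simp add: power2_eq_square field_simps)
    with quad[of "c / a"] have "c\<^sup>2 / a \<le> b" by simp
    then show ?thesis using a by (simp add: divide_le_eq mult.commute)
  qed
  moreover have "cmod (expectation (\<lambda>\<omega>. U \<omega> * V \<omega>)) \<le> c"
    unfolding c_def norm_mult[symmetric] by (rule integral_norm_bound)
  then have "(cmod (expectation (\<lambda>\<omega>. U \<omega> * V \<omega>)))\<^sup>2 \<le> c\<^sup>2"
    by (rule power_mono) simp
  ultimately show ?thesis by (simp add: a_def b_def)
qed

lemma cmod_iexp_diff_square: "(cmod (iexp x - z))\<^sup>2 = 1 - 2 * Re (iexp x * cnj z) + (cmod z)\<^sup>2"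
proof -
  have "(cmod (iexp x - z))\<^sup>2 = (cos x - Re z)\<^sup>2 + (sin x - Im z)\<^sup>2"
    by (simp add: cmod_power2 Re_exp Im_exp)
  also have "\<dots> = ((sin x)\<^sup>2 + (cos x)\<^sup>2) - 2 * (cos x * Re z + sin x * Im z) + ((Re z)\<^sup>2 + (Im z)\<^sup>2)"
    by (simp add: power2_diff algebra_simps)
  also have "\<dots> = 1 - 2 * Re (iexp x * cnj z) + (cmod z)\<^sup>2"
    by (simp only: sin_cos_squared_add) (simp add: cmod_power2 Re_exp Im_exp)
  finally show ?thesis .
qed

context prob_space
begin

lemma integrable_iexp [simp, intro]:
  assumes [measurable]: "f \<in> borel_measurable M"
  shows "integrable M (\<lambda>\<omega>. iexp (f \<omega>))"
  by (rule integrable_const_bound[of _ 1]) auto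

text \<open>
  The variance of a random point on the unit circle with mean \<open>z\<close>.
\<close>
lemma expectation_cmod_iexp_centered:
  assumes [measurable]: "f \<in> borel_measurable M" and z: "z = expectation (\<lambda>\<omega>. iexp (f \<omega>))"
  shows "integrable M (\<lambda>\<omega>. (cmod (iexp (f \<omega>) - z))\<^sup>2)"
    and "expectation (\<lambda>\<omega>. (cmod (iexp (f \<omega>) - z))\<^sup>2) = 1 - (cmod z)\<^sup>2"
proof -
  have i: "integrable M (\<lambda>\<omega>. iexp (f \<omega>) * cnj z)"
    by (rule integrable_mult_left) (rule integrable_iexp, measurable)
  show "integrable M (\<lambda>\<omega>. (cmod (iexp (f \<omega>) - z))\<^sup>2)"
    unfolding cmod_iexp_diff_square using integrable_Re[OF i] by simp
  have "expectation (\<lambda>\<omega>. (cmod (iexp (f \<omega>) - z))\<^sup>2)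
      = 1 - 2 * expectation (\<lambda>\<omega>. Re (iexp (f \<omega>) * cnj z)) + (cmod z)\<^sup>2"
    unfolding cmod_iexp_diff_square using integrable_Re[OF i] by (simp add: prob_space)
  also have "expectation (\<lambda>\<omega>. Re (iexp (f \<omega>) * cnj z)) = Re (expectation (\<lambda>\<omega>. iexp (f \<omega>) * cnj z))"
    by (rule integral_Re[OF i])
  also have "expectation (\<lambda>\<omega>. iexp (f \<omega>) * cnj z) = z * cnj z"
    unfolding z by (rule integral_mult_left_zero)
  also have "Re (z * cnj z) = (cmod z)\<^sup>2"
    by (simp add: cmod_power2) (simp add: power2_eq_square)
  finally show "expectation (\<lambda>\<omega>. (cmod (iexp (f \<omega>) - z))\<^sup>2) = 1 - (cmod z)\<^sup>2"
    by simp
qed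

lemma cmod_charfun_le_1: "cmod (charfun M X t) \<le> 1"
proof -
  have "cmod (charfun M X t) \<le> expectation (\<lambda>\<omega>. cmod (iexp (t \<bullet> X \<omega>)))"
    unfolding charfun_def by (rule integral_norm_bound)
  then show ?thesis by (simp add: prob_space)
qed

lemma Re_charfun:
  assumes [measurable]: "X \<in> borel_measurable M"
  shows "Re (charfun M X t) = expectation (\<lambda>\<omega>. cos (t \<bullet> X \<omega>))"
proof -
  have "Re (charfun M X t) = expectation (\<lambda>\<omega>. Re (iexp (t \<bullet> X \<omega>)))"
    unfolding charfun_def by (rule integral_Re[symmetric]) (rule integrable_iexp, measurable)
  then show ?thesis by (simp add: Re_exp)
qed

text \<open>
  The left-hand side is the squared modulus of the covariance of two random points on the unit circle,
  hence at most the product of their variances \<open>1 - (cmod f)\<^sup>2\<close>. Each of these is at most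
  \<open>2 * (1 - Re f)\<close>, which, unlike the variance, is linear in the distribution; this linearity is why
  the bound integrates to first moments of the single vectors.
\<close>
lemma charfun_covariance_bound:
  assumes [measurable]: "X \<in> borel_measurable M" "Y \<in> borel_measurable M"
  shows "(cmod (joint_charfun M X Y t s - charfun M X t * charfun M Y s))\<^sup>2
      \<le> 4 * ((1 - Re (charfun M X t)) * (1 - Re (charfun M Y s)))"
proof -
  let ?f = "charfun M X t" and ?g = "charfun M Y s"
  let ?e = "\<lambda>\<omega>. iexp (t \<bullet> X \<omega>)" and ?e' = "\<lambda>\<omega>. iexp (s \<bullet> Y \<omega>)"
  have e: "integrable M ?e" "integrable M ?e'"
    by (rule integrable_iexp, measurable)+
  have ee: "integrable M (\<lambda>\<omega>. ?e \<omega> * ?e' \<omega>)"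
    by (rule integrable_const_bound[of _ 1]) (auto simp: norm_mult)
  have "joint_charfun M X Y t s - ?f * ?g = expectation (\<lambda>\<omega>. ?e \<omega> * ?e' \<omega>) - ?f * ?g"
    by (simp add: joint_charfun_def exp_add)
  also have "\<dots> = expectation (\<lambda>\<omega>. ?e \<omega> * ?e' \<omega> - ?f * ?e' \<omega> - ?e \<omega> * ?g + ?f * ?g)"
    using e ee by (simp add: charfun_def prob_space)
  also have "\<dots> = expectation (\<lambda>\<omega>. (?e \<omega> - ?f) * (?e' \<omega> - ?g))"
    by (intro Bochner_Integration.integral_cong refl) (simp add: algebra_simps)
  finally have "(cmod (joint_charfun M X Y t s - ?f * ?g))\<^sup>2
      \<le> expectation (\<lambda>\<omega>. (cmod (?e \<omega> - ?f))\<^sup>2) * expectation (\<lambda>\<omega>. (cmod (?e' \<omega> - ?g))\<^sup>2)"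
    using expectation_cmod_iexp_centered(1)[of "\<lambda>\<omega>. t \<bullet> X \<omega>" ?f]
      expectation_cmod_iexp_centered(1)[of "\<lambda>\<omega>. s \<bullet> Y \<omega>" ?g]
    by (simp only:) (rule cauchy_schwarz_expectation, auto simp: charfun_def)
  also have "\<dots> = (1 - (cmod ?f)\<^sup>2) * (1 - (cmod ?g)\<^sup>2)"
    by (subst (1 2) expectation_cmod_iexp_centered(2)) (auto simp: charfun_def)
  also have "\<dots> \<le> (2 * (1 - Re ?f)) * (2 * (1 - Re ?g))"
  proof -
    have *: "1 - (cmod z)\<^sup>2 \<le> 2 * (1 - Re z)" for z
    proof -
      have "(Re z)\<^sup>2 \<le> (cmod z)\<^sup>2" by (simp add: cmod_power2)
      moreover have "0 \<le> (1 - Re z)\<^sup>2" by simp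
      then have "2 * Re z \<le> 1 + (Re z)\<^sup>2" by (simp add: power2_diff)
      ultimately show ?thesis by simp
    qed
    have "0 \<le> 1 - (cmod ?g)\<^sup>2" "0 \<le> 1 - (cmod ?f)\<^sup>2"
      using power_le_one[OF norm_ge_zero cmod_charfun_le_1[of Y s], of 2]
        power_le_one[OF norm_ge_zero cmod_charfun_le_1[of X t], of 2] by simp_all
    then show ?thesis
      using *[of ?f] *[of ?g] by (intro mult_mono) auto
  qed
  finally show ?thesis by (simp add: algebra_simps)
qed

lemma borel_measurable_charfun [measurable]:
  fixes X :: "'a \<Rightarrow> 'b::euclidean_space"
  assumes [measurable]: "X \<in> borel_measurable M"
  shows "charfun M X \<in> borel_measurable borel"
  unfolding charfun_def by measurable

lemma borel_measurable_joint_charfun [measurable]: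
  fixes X :: "'a \<Rightarrow> 'b::euclidean_space" and Y :: "'a \<Rightarrow> 'c::euclidean_space"
  assumes [measurable]: "X \<in> borel_measurable M" "Y \<in> borel_measurable M"
  shows "(\<lambda>z. joint_charfun M X Y (fst z) (snd z)) \<in> borel_measurable (borel \<Otimes>\<^sub>M borel)"
  unfolding joint_charfun_def by measurable

text \<open>
  Average the cosine representation of the norm over the distribution of \<open>X\<close>; Tonelli applies since the
  integrand is nonnegative.
\<close>
lemma has_bochner_integral_one_minus_charfun:
  fixes X :: "'a \<Rightarrow> 'b::euclidean_space"
  assumes [measurable]: "X \<in> borel_measurable M" and int: "integrable M (\<lambda>\<omega>. norm (X \<omega>))"
  shows "has_bochner_integral lborel (\<lambda>t. (1 - Re (charfun M X t)) / norm t ^ (1 + DIM('b)))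
     (dcov_const DIM('b) * expectation (\<lambda>\<omega>. norm (X \<omega>)))"
proof (rule has_bochner_integral_nn_integral)
  have c: "dcov_const DIM('b) \<ge> 0"
    by (simp add: dcov_const_def Gamma_real_nonneg)
  have Re_le: "Re (charfun M X t) \<le> 1" for t
    using cmod_charfun_le_1[of X t] complex_Re_le_cmod[of "charfun M X t"] by linarith
  then show "AE t in lborel. 0 \<le> (1 - Re (charfun M X t)) / norm t ^ (1 + DIM('b))"
    by simp
  show "0 \<le> dcov_const DIM('b) * expectation (\<lambda>\<omega>. norm (X \<omega>))"
    using c by simp
  have "(\<integral>\<^sup>+t. ennreal ((1 - Re (charfun M X t)) / norm t ^ (1 + DIM('b))) \<partial>lborel)
    = (\<integral>\<^sup>+t. (\<integral>\<^sup>+\<omega>. ennreal ((1 - cos (t \<bullet> X \<omega>)) / norm t ^ (1 + DIM('b))) \<partial>M) \<partial>lborel)"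
  proof (intro nn_integral_cong)
    fix t :: 'b
    have i: "integrable M (\<lambda>\<omega>. cos (t \<bullet> X \<omega>))"
      by (rule integrable_const_bound[of _ 1]) auto
    have "(\<integral>\<^sup>+\<omega>. ennreal ((1 - cos (t \<bullet> X \<omega>)) / norm t ^ (1 + DIM('b))) \<partial>M)
      = ennreal (expectation (\<lambda>\<omega>. (1 - cos (t \<bullet> X \<omega>)) / norm t ^ (1 + DIM('b))))"
      using i by (intro nn_integral_eq_integral) auto
    also have "expectation (\<lambda>\<omega>. (1 - cos (t \<bullet> X \<omega>)) / norm t ^ (1 + DIM('b))) = (1 - Re (charfun M X t)) / norm t ^ (1 + DIM('b))"
      using i by (simp add: Re_charfun prob_space)
    finally show "ennreal ((1 - Re (charfun M X t)) / norm t ^ (1 + DIM('b)))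
      = (\<integral>\<^sup>+\<omega>. ennreal ((1 - cos (t \<bullet> X \<omega>)) / norm t ^ (1 + DIM('b))) \<partial>M)" ..
  qed
  also have "\<dots> = (\<integral>\<^sup>+\<omega>. (\<integral>\<^sup>+t. ennreal ((1 - cos (t \<bullet> X \<omega>)) / norm t ^ (1 + DIM('b))) \<partial>lborel) \<partial>M)"
    by (rule pair_sigma_finite.Fubini'[OF pair_sigma_finite.intro]) (unfold_locales, measurable)
  also have "\<dots> = (\<integral>\<^sup>+\<omega>. ennreal (dcov_const DIM('b) * norm (X \<omega>)) \<partial>M)"
  proof (intro nn_integral_cong)
    fix \<omega>
    show "(\<integral>\<^sup>+t. ennreal ((1 - cos (t \<bullet> X \<omega>)) / norm t ^ (1 + DIM('b))) \<partial>lborel) = ennreal (dcov_const DIM('b) * norm (X \<omega>))"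
      using has_bochner_integral_one_minus_cos[of "X \<omega>"]
      by (subst nn_integral_eq_integral) (auto simp: has_bochner_integral_iff)
  qed
  also have "\<dots> = ennreal (dcov_const DIM('b) * expectation (\<lambda>\<omega>. norm (X \<omega>)))"
    using int c by (subst nn_integral_eq_integral) auto
  finally show "(\<integral>\<^sup>+t. ennreal ((1 - Re (charfun M X t)) / norm t ^ (1 + DIM('b))) \<partial>lborel)
    = ennreal (dcov_const DIM('b) * expectation (\<lambda>\<omega>. norm (X \<omega>)))" .
qed measurable

end

section \<open>The empirical distance covariance\<close>

lemma has_bochner_integral_pair_mult:
  fixes f :: "'a::euclidean_space \<Rightarrow> real" and g :: "'b::euclidean_space \<Rightarrow> real"
  assumes f: "has_bochner_integral lborel f a" and g: "has_bochner_integral lborel g b"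
  shows "has_bochner_integral lborel (\<lambda>z. f (fst z) * g (snd z)) (a * b)"
proof -
  have [measurable]: "f \<in> borel_measurable borel" "g \<in> borel_measurable borel"
    using f g by (auto simp: has_bochner_integral_iff dest: borel_measurable_integrable)
  have "integrable (lborel \<Otimes>\<^sub>M lborel) (\<lambda>z. f (fst z) * g (snd z))"
  proof (rule lborel_pair.Fubini_integrable)
    show "integrable lborel (\<lambda>x. \<integral>y. norm (f (fst (x, y)) * g (snd (x, y))) \<partial>lborel)"
      using f g by (simp add: has_bochner_integral_iff abs_mult)
    show "AE x in lborel. integrable lborel (\<lambda>y. f (fst (x, y)) * g (snd (x, y)))"
      using g by (simp add: has_bochner_integral_iff)
  qed measurable
  moreover from lborel_pair.integral_fst'[OF this]
  have "(\<integral>z. f (fst z) * g (snd z) \<partial>(lborel \<Otimes>\<^sub>M lborel)) = a * b"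
    using f g by (simp add: has_bochner_integral_iff)
  ultimately show ?thesis
    by (simp add: has_bochner_integral_iff lborel_prod)
qed

text \<open>
  Double centring annihilates constants. This matters because \<open>1 - cos\<close> is integrable against the
  singular weight whereas \<open>cos\<close> is not.
\<close>
lemma double_centered_one_minus:
  assumes "n > 0"
  shows "double_centered n (\<lambda>i j. 1 - a i j) k l = - double_centered n a k l"
  using assms by (simp add: double_centered_def sum_subtractf field_simps power2_eq_square)

lemma double_centered_mult:
  "double_centered n (\<lambda>i j. c * a i j) k l = c * double_centered n a k l"
  by (simp add: double_centered_def algebra_simps flip: sum_distrib_left)

lemma has_bochner_integral_double_centered:
  assumes "\<And>i j. has_bochner_integral M (\<lambda>t. a t i j) (A i j)"
  shows "has_bochner_integral M (\<lambda>t. double_centered n (a t) k l) (double_centered n A k l)"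
  unfolding double_centered_def
  by (intro has_bochner_integral_add has_bochner_integral_diff has_bochner_integral_mult_right
      has_bochner_integral_sum assms)

text \<open>
  Centring a vector centres its Gram matrix in both indices.
\<close>
lemma double_centered_Re_mult_cnj:
  fixes a :: "nat \<Rightarrow> complex" and n k l :: nat
  defines "m \<equiv> (\<Sum>i<n. a i) / of_nat n"
  shows "Re ((a k - m) * cnj (a l - m)) = double_centered n (\<lambda>i j. Re (a i * cnj (a j))) k l"
proof -
  have 1: "a k * cnj m = 1 / of_nat n * (\<Sum>j<n. a k * cnj (a j))"
    by (simp add: m_def sum_distrib_left sum_divide_distrib)
  have 2: "m * cnj (a l) = 1 / of_nat n * (\<Sum>i<n. a i * cnj (a l))"
    by (simp add: m_def sum_distrib_right sum_divide_distrib)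
  have 3: "m * cnj m = 1 / (of_nat n)\<^sup>2 * (\<Sum>i<n. \<Sum>j<n. a i * cnj (a j))"
    by (simp add: m_def sum_product power2_eq_square sum_divide_distrib)
  have "(a k - m) * cnj (a l - m) = a k * cnj (a l) - a k * cnj m - m * cnj (a l) + m * cnj m"
    by (simp add: algebra_simps)
  also have "\<dots> = a k * cnj (a l) - complex_of_real (1 / real n) * (\<Sum>j<n. a k * cnj (a j))
      - complex_of_real (1 / real n) * (\<Sum>i<n. a i * cnj (a l))
      + complex_of_real (1 / (real n)\<^sup>2) * (\<Sum>i<n. \<Sum>j<n. a i * cnj (a j))"
    unfolding 1 2 3 by simp
  finally show ?thesis
    by (simp only: double_centered_def plus_complex.sel minus_complex.sel Re_sum Re_complex_of_real
        times_complex.sel Im_complex_of_real mult_zero_left diff_zero)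
qed

lemma integral_uniform_count_lessThan:
  fixes f :: "nat \<Rightarrow> 'a::{banach, second_countable_topology}"
  shows "integral\<^sup>L (uniform_count_measure {..<n}) f = (1 / real n) *\<^sub>R (\<Sum>k<n. f k)"
  by (simp add: uniform_count_measure_def lebesgue_integral_point_measure_finite scaleR_sum_right)

lemma cmod_sum_square:
  fixes z :: "nat \<Rightarrow> complex"
  shows "(cmod (\<Sum>k<n. z k))\<^sup>2 = (\<Sum>k<n. \<Sum>l<n. Re (z k * cnj (z l)))"
proof -
  have "complex_of_real ((cmod (\<Sum>k<n. z k))\<^sup>2) = (\<Sum>k<n. z k) * cnj (\<Sum>k<n. z k)"
    by (rule complex_norm_square)
  also have "\<dots> = (\<Sum>k<n. \<Sum>l<n. z k * cnj (z l))"
    by (simp add: sum_product)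
  finally have "Re (complex_of_real ((cmod (\<Sum>k<n. z k))\<^sup>2)) = Re (\<Sum>k<n. \<Sum>l<n. z k * cnj (z l))"
    by (rule arg_cong)
  then show ?thesis by (simp only: Re_complex_of_real Re_sum)
qed

text \<open>
  With the centred characters \<open>u\<^sub>k(t)\<close> and \<open>v\<^sub>k(s)\<close> of the sample points, \<open>\<xi>(t, s)\<close> is the average of
  \<open>u\<^sub>k(t) * v\<^sub>k(s)\<close>, so its squared modulus is the average over \<open>k\<close> and \<open>l\<close> of the real part of
  \<open>(u\<^sub>k * cnj u\<^sub>l) * (v\<^sub>k * cnj v\<^sub>l)\<close>. This contains products of imaginary parts, which are odd in \<open>t\<close>; adding the
  value at \<open>- t\<close> removes them and leaves products of double-centred real kernels.
\<close>
lemma symmetrised_charfun_covariance: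
  fixes x :: "nat \<Rightarrow> 'a::euclidean_space" and y :: "nat \<Rightarrow> 'b::euclidean_space"
  assumes n: "n > 0"
  defines "U \<equiv> uniform_count_measure {..<n}"
  defines "\<xi> \<equiv> \<lambda>t s. joint_charfun U x y t s - charfun U x t * charfun U y s"
  shows "(cmod (\<xi> t s))\<^sup>2 + (cmod (\<xi> (- t) s))\<^sup>2 = 2 / (real n)\<^sup>2 * (\<Sum>k<n. \<Sum>l<n.
     double_centered n (\<lambda>i j. 1 - cos (t \<bullet> (x i - x j))) k l *
     double_centered n (\<lambda>i j. 1 - cos (s \<bullet> (y i - y j))) k l)"
proof -
  define a where "a t k = iexp (t \<bullet> x k)" for t k
  define b where "b k = iexp (s \<bullet> y k)" for k
  define u where "u t k = a t k - (\<Sum>i<n. a t i) / of_nat n" for t k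
  define v where "v k = b k - (\<Sum>i<n. b i) / of_nat n" for k
  define N where "N = (of_nat n :: complex)"
  have N: "N \<noteq> 0" using n by (simp add: N_def)
  have xi: "\<xi> t s = (\<Sum>k<n. u t k * v k) / N" for t
  proof -
    have "(\<Sum>k<n. u t k * v k) = (\<Sum>k<n. a t k * b k) - (\<Sum>k<n. a t k) * ((\<Sum>i<n. b i) / N)
        - (\<Sum>i<n. a t i) / N * (\<Sum>k<n. b k) + N * ((\<Sum>i<n. a t i) / N * ((\<Sum>i<n. b i) / N))"
      by (simp add: u_def v_def N_def left_diff_distrib right_diff_distrib sum_subtractf sum_distrib_left sum_distrib_right
          del: times_divide_eq_left times_divide_eq_right)
    also have "\<dots> = (\<Sum>k<n. a t k * b k) - (\<Sum>k<n. a t k) * (\<Sum>k<n. b k) / N"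
      using N by (simp add: field_simps)
    finally have uv: "(\<Sum>k<n. u t k * v k) = (\<Sum>k<n. a t k * b k) - (\<Sum>k<n. a t k) * (\<Sum>k<n. b k) / N" .
    have "\<xi> t s = (\<Sum>k<n. a t k * b k) / N - ((\<Sum>k<n. a t k) / N) * ((\<Sum>k<n. b k) / N)"
      by (simp add: \<xi>_def U_def joint_charfun_def charfun_def integral_uniform_count_lessThan
          a_def b_def exp_add scaleR_conv_of_real N_def)
    then show ?thesis
      unfolding uv by (simp add: diff_divide_distrib)
  qed
  \<comment> \<open>Reflecting \<open>t\<close> conjugates the first factor, which makes the imaginary parts cancel in the sum.\<close>
  have u_minus: "u (- t) k = cnj (u t k)" for k
    by (simp add: u_def a_def exp_cnj)
  have sq: "(cmod (\<xi> t s))\<^sup>2 = 1 / (real n)\<^sup>2 * (\<Sum>k<n. \<Sum>l<n. Re ((u t k * cnj (u t l)) * (v k * cnj (v l))))" for t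
    by (simp add: xi N_def norm_divide power_divide cmod_sum_square mult_ac)
  have dc_u: "Re (u t k * cnj (u t l)) = - double_centered n (\<lambda>i j. 1 - cos (t \<bullet> (x i - x j))) k l" for k l
  proof -
    have "Re (a t i * cnj (a t j)) = cos (t \<bullet> (x i - x j))" for i j
      by (simp add: a_def inner_diff_right cos_diff Re_exp Im_exp)
    then show ?thesis
      using double_centered_Re_mult_cnj[of "a t" k n l]
      by (simp only: u_def double_centered_one_minus[OF n] minus_minus)
  qed
  have dc_v: "Re (v k * cnj (v l)) = - double_centered n (\<lambda>i j. 1 - cos (s \<bullet> (y i - y j))) k l" for k l
  proof -
    have "Re (b i * cnj (b j)) = cos (s \<bullet> (y i - y j))" for i j
      by (simp add: b_def inner_diff_right cos_diff Re_exp Im_exp)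
    then show ?thesis
      using double_centered_Re_mult_cnj[of "b" k n l]
      by (simp only: v_def double_centered_one_minus[OF n] minus_minus)
  qed
  have Re2: "Re (z * w) + Re (cnj z * w) = 2 * (Re z * Re w)" for z w
    by simp
  have "(cmod (\<xi> t s))\<^sup>2 + (cmod (\<xi> (- t) s))\<^sup>2 = 1 / (real n)\<^sup>2 * (\<Sum>k<n. \<Sum>l<n.
      Re ((u t k * cnj (u t l)) * (v k * cnj (v l))) + Re (cnj (u t k * cnj (u t l)) * (v k * cnj (v l))))"
    by (simp only: sq u_minus sum.distrib distrib_left complex_cnj_mult)
  also have "\<dots> = 1 / (real n)\<^sup>2 * (\<Sum>k<n. \<Sum>l<n. 2 * (Re (u t k * cnj (u t l)) * Re (v k * cnj (v l))))"
    by (simp only: Re2)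
  also have "\<dots> = 2 / (real n)\<^sup>2 * (\<Sum>k<n. \<Sum>l<n. Re (u t k * cnj (u t l)) * Re (v k * cnj (v l)))"
    by (simp add: sum_distrib_left)
  finally show ?thesis
    by (simp only: dc_u dc_v minus_mult_minus)
qed

lemma lborel_distr_uminus_euclidean:
  "distr lborel borel uminus = (lborel :: 'a::euclidean_space measure)"
  using lborel_affine[of "- 1" "0::'a"] by (simp add: density_1 one_ennreal_def[symmetric] comp_def)

lemma integral_lborel_reflect_fst:
  fixes F :: "'a::euclidean_space \<times> 'b::euclidean_space \<Rightarrow> real"
  assumes F: "integrable lborel F" and F': "integrable lborel (\<lambda>z. F (- fst z, snd z))"
  shows "(\<integral>z. F (- fst z, snd z) \<partial>lborel) = (\<integral>z. F z \<partial>lborel)"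
proof -
  have [measurable]: "F \<in> borel_measurable borel"
    using borel_measurable_integrable[OF F] by simp
  have inner: "(\<integral>t. F (- t, s) \<partial>lborel) = (\<integral>t. F (t, s) \<partial>lborel)" for s
  proof -
    have "(\<integral>t. F (t, s) \<partial>(distr lborel borel uminus)) = (\<integral>t. F (- t, s) \<partial>lborel)"
      by (rule integral_distr) measurable
    then show ?thesis by (simp add: lborel_distr_uminus_euclidean)
  qed
  have "(\<integral>z. F (- fst z, snd z) \<partial>(lborel \<Otimes>\<^sub>M lborel)) = (\<integral>s. \<integral>t. F (- t, s) \<partial>lborel \<partial>lborel)"
    using lborel_pair.integral_snd[of "\<lambda>t s. F (- t, s)"] F' by (simp add: lborel_prod case_prod_beta')
  also have "\<dots> = (\<integral>z. F z \<partial>(lborel \<Otimes>\<^sub>M lborel))"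
    using lborel_pair.integral_snd[of "\<lambda>t s. F (t, s)"] F by (simp add: lborel_prod inner)
  finally show ?thesis by (simp add: lborel_prod)
qed


definition dcov_integrand ::
  "'w measure \<Rightarrow> ('w \<Rightarrow> 'a::euclidean_space) \<Rightarrow> ('w \<Rightarrow> 'b::euclidean_space) \<Rightarrow> 'a \<times> 'b \<Rightarrow> real"
where
  "dcov_integrand M X Y z =
     (cmod (joint_charfun M X Y (fst z) (snd z) - charfun M X (fst z) * charfun M Y (snd z)))\<^sup>2 /
     (norm (fst z) ^ (1 + DIM('a)) * norm (snd z) ^ (1 + DIM('b)))"

text \<open>
  Twice the bound \<open>1 - Re f\<close> of each marginal, with the weight distributed over the two factors so that
  the integral splits into a product.
\<close>
definition dcov_majorant ::
  "'w measure \<Rightarrow> ('w \<Rightarrow> 'a::euclidean_space) \<Rightarrow> ('w \<Rightarrow> 'b::euclidean_space) \<Rightarrow> 'a \<times> 'b \<Rightarrow> real"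
where
  "dcov_majorant M X Y z =
     4 * ((1 - Re (charfun M X (fst z))) / norm (fst z) ^ (1 + DIM('a)) *
          ((1 - Re (charfun M Y (snd z))) / norm (snd z) ^ (1 + DIM('b))))"

lemma dcov_eq_integrand:
  fixes X :: "'w \<Rightarrow> 'a::euclidean_space" and Y :: "'w \<Rightarrow> 'b::euclidean_space"
  shows "dcov M X Y = sqrt (1 / (dcov_const DIM('a) * dcov_const DIM('b)) * integral\<^sup>L lborel (dcov_integrand M X Y))"
  by (simp add: dcov_def dcov_integrand_def[abs_def] case_prod_beta')

lemma dcov_integrand_nonneg: "0 \<le> dcov_integrand M X Y z"
  by (simp add: dcov_integrand_def)

lemma dcov_const_pos: "dcov_const d > 0"
  by (simp add: dcov_const_def Gamma_real_pos)

context prob_space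
begin

lemma dcov_integrand_le_majorant:
  fixes X :: "'a \<Rightarrow> 'b::euclidean_space" and Y :: "'a \<Rightarrow> 'c::euclidean_space"
  assumes "X \<in> borel_measurable M" "Y \<in> borel_measurable M"
  shows "dcov_integrand M X Y z \<le> dcov_majorant M X Y z"
  using divide_right_mono[OF charfun_covariance_bound[OF assms, of "fst z" "snd z"],
      of "norm (fst z) ^ (1 + DIM('b)) * norm (snd z) ^ (1 + DIM('c))"]
  by (simp add: dcov_integrand_def dcov_majorant_def)

lemma borel_measurable_dcov_integrand:
  fixes X :: "'a \<Rightarrow> 'b::euclidean_space" and Y :: "'a \<Rightarrow> 'c::euclidean_space"
  assumes [measurable]: "X \<in> borel_measurable M" "Y \<in> borel_measurable M"
  shows "dcov_integrand M X Y \<in> borel_measurable borel"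
  unfolding dcov_integrand_def[abs_def] borel_prod[symmetric] by measurable

lemma has_bochner_integral_dcov_majorant:
  fixes X :: "'a \<Rightarrow> 'b::euclidean_space" and Y :: "'a \<Rightarrow> 'c::euclidean_space"
  assumes "X \<in> borel_measurable M" "Y \<in> borel_measurable M"
    and "integrable M (\<lambda>\<omega>. norm (X \<omega>))" "integrable M (\<lambda>\<omega>. norm (Y \<omega>))"
  shows "has_bochner_integral lborel (dcov_majorant M X Y)
     (4 * (dcov_const DIM('b) * expectation (\<lambda>\<omega>. norm (X \<omega>)) * (dcov_const DIM('c) * expectation (\<lambda>\<omega>. norm (Y \<omega>)))))"
  unfolding dcov_majorant_def[abs_def]
  by (intro has_bochner_integral_mult_right has_bochner_integral_pair_mult has_bochner_integral_one_minus_charfun assms)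

lemma integrable_dcov_integrand:
  fixes X :: "'a \<Rightarrow> 'b::euclidean_space" and Y :: "'a \<Rightarrow> 'c::euclidean_space"
  assumes XY: "X \<in> borel_measurable M" "Y \<in> borel_measurable M"
    and int: "integrable M (\<lambda>\<omega>. norm (X \<omega>))" "integrable M (\<lambda>\<omega>. norm (Y \<omega>))"
  shows "integrable lborel (dcov_integrand M X Y)"
proof (rule Bochner_Integration.integrable_bound)
  show "integrable lborel (dcov_majorant M X Y)"
    using has_bochner_integral_dcov_majorant[OF assms] by (simp add: has_bochner_integral_iff)
  show "dcov_integrand M X Y \<in> borel_measurable lborel"
    using borel_measurable_dcov_integrand[OF XY] by simp
  show "AE z in lborel. norm (dcov_integrand M X Y z) \<le> norm (dcov_majorant M X Y z)"
    using dcov_integrand_le_majorant[OF XY] dcov_integrand_nonneg[of M X Y]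
    by (intro AE_I2) (metis abs_of_nonneg order_trans real_norm_def)
qed

end

text \<open>
  Reflection in \<open>t\<close> preserves the integral, so the integrand may be replaced by its symmetrisation, a
  finite combination of products of a function of \<open>t\<close> and a function of \<open>s\<close>. Each factor is a double
  centring of \<open>1 - cos\<close> kernels and integrates to the double-centred distance matrix times the
  normalising constant.
\<close>
lemma empirical_dcov_eq_dcov:
  fixes x :: "nat \<Rightarrow> 'a::euclidean_space" and y :: "nat \<Rightarrow> 'b::euclidean_space"
  assumes n: "n > 0"
  shows "empirical_dcov n x y = dcov (uniform_count_measure {..<n}) x y"
proof -
  define U where "U = uniform_count_measure {..<n}"
  let ?c = "dcov_const DIM('a)" and ?c' = "dcov_const DIM('b)"
  interpret U: prob_space U
    unfolding U_def by (rule prob_space_uniform_count_measure) (use n in auto)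
  have meas: "f \<in> borel_measurable U" for f :: "nat \<Rightarrow> 'c::topological_space"
    by (simp add: U_def uniform_count_measure_def)
  have int: "integrable U f" for f :: "nat \<Rightarrow> real"
    by (simp add: U_def uniform_count_measure_def integrable_point_measure_finite)
  let ?F = "dcov_integrand U x y"
  have F: "integrable lborel ?F"
    by (rule U.integrable_dcov_integrand) (rule meas int)+
  \<comment> \<open>Reflecting \<open>t\<close> amounts to reflecting the first sample, so integrability carries over.\<close>
  have F_reflect: "?F (- fst z, snd z) = dcov_integrand U (\<lambda>k. - x k) y z" for z
    by (simp add: dcov_integrand_def charfun_def joint_charfun_def)
  have F': "integrable lborel (\<lambda>z. ?F (- fst z, snd z))"
    unfolding F_reflect by (rule U.integrable_dcov_integrand) (rule meas int)+
  define P where "P t = double_centered n (\<lambda>i j. (1 - cos (t \<bullet> (x i - x j))) / norm t ^ (1 + DIM('a)))" for t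
  define Q where "Q s = double_centered n (\<lambda>i j. (1 - cos (s \<bullet> (y i - y j))) / norm s ^ (1 + DIM('b)))" for s
  define A where "A = double_centered n (\<lambda>i j. norm (x i - x j))"
  define B where "B = double_centered n (\<lambda>i j. norm (y i - y j))"
  have "has_bochner_integral lborel (\<lambda>t. P t k l) (?c * A k l)" for k l
    unfolding P_def A_def double_centered_mult[symmetric]
    by (intro has_bochner_integral_double_centered has_bochner_integral_one_minus_cos)
  moreover have "has_bochner_integral lborel (\<lambda>s. Q s k l) (?c' * B k l)" for k l
    unfolding Q_def B_def double_centered_mult[symmetric]
    by (intro has_bochner_integral_double_centered has_bochner_integral_one_minus_cos)
  ultimately have PQ: "has_bochner_integral lborel
      (\<lambda>z. 2 / (real n)\<^sup>2 * (\<Sum>k<n. \<Sum>l<n. P (fst z) k l * Q (snd z) k l))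
      (2 / (real n)\<^sup>2 * (\<Sum>k<n. \<Sum>l<n. (?c * A k l) * (?c' * B k l)))"
    by (intro has_bochner_integral_mult_right has_bochner_integral_sum has_bochner_integral_pair_mult)
  have sym: "?F z + ?F (- fst z, snd z) = 2 / (real n)\<^sup>2 * (\<Sum>k<n. \<Sum>l<n. P (fst z) k l * Q (snd z) k l)" for z
  proof -
    have dc: "double_centered n (\<lambda>i j. a i j / c) k l = double_centered n a k l / c" for a c k l
      using double_centered_mult[of n "1 / c" a k l] by simp
    let ?w = "norm (fst z) ^ (1 + DIM('a)) * norm (snd z) ^ (1 + DIM('b))"
    have "?F z + ?F (- fst z, snd z) = (2 / (real n)\<^sup>2 * (\<Sum>k<n. \<Sum>l<n.
     double_centered n (\<lambda>i j. 1 - cos (fst z \<bullet> (x i - x j))) k l *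
     double_centered n (\<lambda>i j. 1 - cos (snd z \<bullet> (y i - y j))) k l)) / ?w"
      unfolding symmetrised_charfun_covariance[OF n, symmetric]
      by (simp add: dcov_integrand_def U_def add_divide_distrib)
    also have "\<dots> = 2 / (real n)\<^sup>2 * (\<Sum>k<n. \<Sum>l<n. P (fst z) k l * Q (snd z) k l)"
    proof -
      have "P (fst z) k l * Q (snd z) k l = double_centered n (\<lambda>i j. 1 - cos (fst z \<bullet> (x i - x j))) k l *
          double_centered n (\<lambda>i j. 1 - cos (snd z \<bullet> (y i - y j))) k l / ?w" for k l
        by (simp only: P_def Q_def dc times_divide_times_eq)
      then show ?thesis
        by (simp only: sum_divide_distrib[symmetric] times_divide_eq_right)
    qed
    finally show ?thesis .
  qed
  have "2 * integral\<^sup>L lborel ?F = (\<integral>z. ?F z + ?F (- fst z, snd z) \<partial>lborel)"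
    using integral_lborel_reflect_fst[OF F F'] Bochner_Integration.integral_add[OF F F'] by simp
  also have "\<dots> = 2 / (real n)\<^sup>2 * (\<Sum>k<n. \<Sum>l<n. (?c * A k l) * (?c' * B k l))"
    unfolding sym using PQ by (simp add: has_bochner_integral_iff)
  also have "\<dots> = 2 * ((?c * ?c') * (1 / (real n)\<^sup>2 * (\<Sum>k<n. \<Sum>l<n. A k l * B k l)))"
    by (simp add: sum_distrib_left mult_ac)
  finally have "integral\<^sup>L lborel ?F = (?c * ?c') * (1 / (real n)\<^sup>2 * (\<Sum>k<n. \<Sum>l<n. A k l * B k l))"
    by simp
  then have "1 / (?c * ?c') * integral\<^sup>L lborel ?F = 1 / (real n)\<^sup>2 * (\<Sum>k<n. \<Sum>l<n. A k l * B k l)"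
    using dcov_const_pos[of "DIM('a)"] dcov_const_pos[of "DIM('b)"] by simp
  then show ?thesis
    by (simp add: empirical_dcov_def dcov_eq_integrand A_def B_def U_def)
qed

section \<open>Almost sure convergence\<close>

text \<open>
  The exceptional null set of the strong law depends on the parameter \<open>u\<close>. Since the event of
  convergence is jointly measurable in \<open>(\<omega>, u)\<close>, Tonelli makes almost every \<open>\<omega>\<close> work for almost every \<open>u\<close>.
\<close>

lemma (in prob_space) AE_average_tendsto_AE_parameter:
  fixes Z :: "nat \<Rightarrow> 'a \<Rightarrow> 'b" and \<phi> :: "'b \<Rightarrow> 'c \<Rightarrow> complex"
  assumes L: "sigma_finite_measure L"
    and ind: "indep_vars (\<lambda>_. N) Z UNIV"
    and id: "\<And>k. distr M N (Z k) = distr M N W"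
    and W[measurable]: "W \<in> M \<rightarrow>\<^sub>M N"
    and \<phi>[measurable]: "(\<lambda>(z, u). \<phi> z u) \<in> borel_measurable (N \<Otimes>\<^sub>M L)"
    and bound: "\<And>z u. cmod (\<phi> z u) \<le> 1"
  shows "AE \<omega> in M. AE u in L. (\<lambda>n. (\<Sum>k<n. \<phi> (Z k \<omega>) u) / of_nat n) \<longlonglongrightarrow> expectation (\<lambda>\<omega>. \<phi> (W \<omega>) u)"
proof -
  interpret L: sigma_finite_measure L by (rule L)
  interpret P: pair_sigma_finite M L ..
  have rv[measurable]: "Z k \<in> M \<rightarrow>\<^sub>M N" for k
    using ind by (auto simp: indep_vars_def)
  have "AE u in L. AE \<omega> in M. (\<lambda>n. (\<Sum>k<n. \<phi> (Z k \<omega>) u) / of_nat n) \<longlonglongrightarrow> expectation (\<lambda>\<omega>. \<phi> (W \<omega>) u)"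
  proof (rule AE_I2)
    fix u assume [measurable]: "u \<in> space L"
    show "AE \<omega> in M. (\<lambda>n. (\<Sum>k<n. \<phi> (Z k \<omega>) u) / of_nat n) \<longlonglongrightarrow> expectation (\<lambda>\<omega>. \<phi> (W \<omega>) u)"
    proof (rule strong_law_of_large_numbers_complex[OF ind id W])
      show "(\<lambda>z. \<phi> z u) \<in> borel_measurable N" by measurable
      then show "integrable M (\<lambda>\<omega>. \<phi> (W \<omega>) u)"
        by (intro integrable_const_bound[of _ 1]) (auto simp: bound)
    qed
  qed
  moreover have "{z \<in> space (M \<Otimes>\<^sub>M L). (\<lambda>n. (\<Sum>k<n. \<phi> (Z k (fst z)) (snd z)) / of_nat n)
      \<longlonglongrightarrow> expectation (\<lambda>\<omega>. \<phi> (W \<omega>) (snd z))} \<in> sets (M \<Otimes>\<^sub>M L)"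
  proof -
    define F where "F n z = (\<Sum>k<n. \<phi> (Z k (fst z)) (snd z)) / of_nat n" for n z
    define G where "G z = expectation (\<lambda>\<omega>. \<phi> (W \<omega>) (snd z))" for z :: "'a \<times> 'c"
    have [measurable]: "F n \<in> borel_measurable (M \<Otimes>\<^sub>M L)" for n
      unfolding F_def by measurable
    have [measurable]: "G \<in> borel_measurable (M \<Otimes>\<^sub>M L)"
      unfolding G_def by measurable
    have "(\<lambda>n. F n z) \<longlonglongrightarrow> G z \<longleftrightarrow> (\<forall>m. \<exists>n0. \<forall>n\<ge>n0. dist (F n z) (G z) < inverse (real (Suc m)))" for z
    proof
      assume R: "\<forall>m. \<exists>n0. \<forall>n\<ge>n0. dist (F n z) (G z) < inverse (real (Suc m))"
      show "(\<lambda>n. F n z) \<longlonglongrightarrow> G z"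
        unfolding lim_sequentially
      proof (intro allI impI)
        fix r :: real assume "r > 0"
        then obtain m where m: "inverse (real (Suc m)) < r" using reals_Archimedean by blast
        from R obtain n0 where "\<forall>n\<ge>n0. dist (F n z) (G z) < inverse (real (Suc m))" by blast
        with m show "\<exists>n0. \<forall>n\<ge>n0. dist (F n z) (G z) < r" by (meson less_trans)
      qed
    qed (simp add: lim_sequentially)
    then have "{z \<in> space (M \<Otimes>\<^sub>M L). (\<lambda>n. F n z) \<longlonglongrightarrow> G z} =
      {z \<in> space (M \<Otimes>\<^sub>M L). \<forall>m. \<exists>n0. \<forall>n\<ge>n0. dist (F n z) (G z) < inverse (real (Suc m))}"
      by simp
    also have "\<dots> \<in> sets (M \<Otimes>\<^sub>M L)" by measurable
    finally show ?thesis by (simp only: F_def G_def)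
  qed
  ultimately show ?thesis
    by (subst P.AE_commute)
qed

theorem theorem2:
  fixes M :: "'w measure"
    and X :: "'w \<Rightarrow> real ^ 'p::finite"
    and Y :: "'w \<Rightarrow> real ^ 'q::finite"
    and Xs :: "nat \<Rightarrow> 'w \<Rightarrow> real ^ 'p"
    and Ys :: "nat \<Rightarrow> 'w \<Rightarrow> real ^ 'q"
  assumes "prob_space M"
    and "X \<in> borel_measurable M"
    and "Y \<in> borel_measurable M"
    and "prob_space.indep_vars M (\<lambda>_. borel) (\<lambda>k \<omega>. (Xs k \<omega>, Ys k \<omega>)) UNIV"
    and "\<And>k. distr M borel (\<lambda>\<omega>. (Xs k \<omega>, Ys k \<omega>)) = distr M borel (\<lambda>\<omega>. (X \<omega>, Y \<omega>))"
    and "integrable M (\<lambda>\<omega>. norm (X \<omega>))"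
    and "integrable M (\<lambda>\<omega>. norm (Y \<omega>))"
  shows "AE \<omega> in M. (\<lambda>n. empirical_dcov n (\<lambda>k. Xs k \<omega>) (\<lambda>k. Ys k \<omega>)) \<longlonglongrightarrow> dcov M X Y"
proof -
  interpret prob_space M by fact
  note XY[measurable] = assms(2,3) and ind = assms(4) and id = assms(5) and int = assms(6,7)
  let ?L = "lborel :: ((real ^ 'p) \<times> (real ^ 'q)) measure"
  \<comment> \<open>For fixed \<open>\<omega>\<close>, the first \<open>n + 1\<close> observations are random vectors on the uniform probability
    space \<open>U n\<close> of their indices; the shift avoids the empty sample,
    for which there is no probability measure.\<close>
  define U where "U n = uniform_count_measure {..<Suc n}" for n
  have W: "(\<lambda>\<omega>. (X \<omega>, Y \<omega>)) \<in> borel_measurable M" by measurable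
  have sigma: "sigma_finite_measure ?L" by (rule sigma_finite_lborel)
  have norms: "AE \<omega> in M. (\<lambda>n. (\<Sum>k<n. norm (Xs k \<omega>)) / real n) \<longlonglongrightarrow> expectation (\<lambda>\<omega>. norm (X \<omega>))"
    "AE \<omega> in M. (\<lambda>n. (\<Sum>k<n. norm (Ys k \<omega>)) / real n) \<longlonglongrightarrow> expectation (\<lambda>\<omega>. norm (Y \<omega>))"
  proof -
    have *: "(\<lambda>n. (\<Sum>k<n. a k) / real n) \<longlonglongrightarrow> b"
      if "(\<lambda>n. (\<Sum>k<n. complex_of_real (a k)) / of_nat n) \<longlonglongrightarrow> complex_of_real b" for a b
      using tendsto_Re[OF that] by simp
    have "(\<lambda>z :: (real ^ 'p) \<times> (real ^ 'q). complex_of_real (norm (fst z))) \<in> borel_measurable borel"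
      unfolding borel_prod[symmetric] by measurable
    from strong_law_of_large_numbers_complex[OF ind id W this]
    have "AE \<omega> in M. (\<lambda>n. (\<Sum>k<n. complex_of_real (norm (Xs k \<omega>))) / of_nat n)
        \<longlonglongrightarrow> complex_of_real (expectation (\<lambda>\<omega>. norm (X \<omega>)))"
      using int by simp
    then show "AE \<omega> in M. (\<lambda>n. (\<Sum>k<n. norm (Xs k \<omega>)) / real n) \<longlonglongrightarrow> expectation (\<lambda>\<omega>. norm (X \<omega>))"
      by eventually_elim (rule *)
    have "(\<lambda>z :: (real ^ 'p) \<times> (real ^ 'q). complex_of_real (norm (snd z))) \<in> borel_measurable borel"
      unfolding borel_prod[symmetric] by measurable
    from strong_law_of_large_numbers_complex[OF ind id W this]
    have "AE \<omega> in M. (\<lambda>n. (\<Sum>k<n. complex_of_real (norm (Ys k \<omega>))) / of_nat n)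
        \<longlonglongrightarrow> complex_of_real (expectation (\<lambda>\<omega>. norm (Y \<omega>)))"
      using int by simp
    then show "AE \<omega> in M. (\<lambda>n. (\<Sum>k<n. norm (Ys k \<omega>)) / real n) \<longlonglongrightarrow> expectation (\<lambda>\<omega>. norm (Y \<omega>))"
      by eventually_elim (rule *)
  qed
  note average = AE_average_tendsto_AE_parameter[OF sigma ind id W]
  have cf_joint: "AE \<omega> in M. AE u in ?L. (\<lambda>n. (\<Sum>k<n. exp (\<i> * complex_of_real (fst u \<bullet> Xs k \<omega>) + \<i> * complex_of_real (snd u \<bullet> Ys k \<omega>))) / of_nat n)
      \<longlonglongrightarrow> joint_charfun M X Y (fst u) (snd u)"
  proof -
    let ?\<phi> = "\<lambda>z u. exp (\<i> * complex_of_real (fst u \<bullet> fst z) + \<i> * complex_of_real (snd u \<bullet> snd z))"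
    have "(\<lambda>(z, u). ?\<phi> z u) \<in> borel_measurable (borel \<Otimes>\<^sub>M ?L)"
      unfolding borel_prod[symmetric] lborel_prod[symmetric] by measurable
    from average[OF this] show ?thesis
      by (simp add: joint_charfun_def)
  qed
  have cf_X: "AE \<omega> in M. AE u in ?L. (\<lambda>n. (\<Sum>k<n. iexp (fst u \<bullet> Xs k \<omega>)) / of_nat n)
      \<longlonglongrightarrow> charfun M X (fst u)"
  proof -
    let ?\<phi> = "\<lambda>z u. iexp (fst u \<bullet> fst z)"
    have "(\<lambda>(z, u). ?\<phi> z u) \<in> borel_measurable ((borel :: ((real ^ 'p) \<times> (real ^ 'q)) measure) \<Otimes>\<^sub>M ?L)"
      unfolding borel_prod[symmetric] lborel_prod[symmetric] by measurable
    from average[OF this] show ?thesis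
      by (simp add: charfun_def)
  qed
  have cf_Y: "AE \<omega> in M. AE u in ?L. (\<lambda>n. (\<Sum>k<n. iexp (snd u \<bullet> Ys k \<omega>)) / of_nat n)
      \<longlonglongrightarrow> charfun M Y (snd u)"
  proof -
    let ?\<phi> = "\<lambda>z u. iexp (snd u \<bullet> snd z)"
    have "(\<lambda>(z, u). ?\<phi> z u) \<in> borel_measurable ((borel :: ((real ^ 'p) \<times> (real ^ 'q)) measure) \<Otimes>\<^sub>M ?L)"
      unfolding borel_prod[symmetric] lborel_prod[symmetric] by measurable
    from average[OF this] show ?thesis
      by (simp add: charfun_def)
  qed
  from norms cf_joint cf_X cf_Y show ?thesis
  proof eventually_elim
    case (elim \<omega>)
    let ?x = "\<lambda>k. Xs k \<omega>" and ?y = "\<lambda>k. Ys k \<omega>"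
    have U: "prob_space (U n)" for n
      unfolding U_def by (rule prob_space_uniform_count_measure) auto
    have meas: "f \<in> borel_measurable (U n)" for f :: "nat \<Rightarrow> 'c::topological_space" and n
      by (simp add: U_def uniform_count_measure_def)
    have int_U: "integrable (U n) f" for f :: "nat \<Rightarrow> real" and n
      by (simp add: U_def uniform_count_measure_def integrable_point_measure_finite)
    have avg: "integral\<^sup>L (U n) f = (\<Sum>k<Suc n. f k) / of_nat (Suc n)" for f :: "nat \<Rightarrow> 'c::{banach, second_countable_topology, real_normed_field}" and n
      unfolding U_def integral_uniform_count_lessThan by (simp add: scaleR_conv_of_real divide_inverse mult.commute)
    have lim_joint: "AE u in ?L. (\<lambda>n. joint_charfun (U n) ?x ?y (fst u) (snd u)) \<longlonglongrightarrow> joint_charfun M X Y (fst u) (snd u)"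
      using elim(3) unfolding joint_charfun_def avg by (rule AE_mp) (intro AE_I2 impI, erule LIMSEQ_Suc)
    have lim_X: "AE u in ?L. (\<lambda>n. charfun (U n) ?x (fst u)) \<longlonglongrightarrow> charfun M X (fst u)"
      using elim(4) unfolding charfun_def avg by (rule AE_mp) (intro AE_I2 impI, erule LIMSEQ_Suc)
    have lim_Y: "AE u in ?L. (\<lambda>n. charfun (U n) ?y (snd u)) \<longlonglongrightarrow> charfun M Y (snd u)"
      using elim(5) unfolding charfun_def avg by (rule AE_mp) (intro AE_I2 impI, erule LIMSEQ_Suc)
    have maj: "has_bochner_integral ?L (dcov_majorant (U n) ?x ?y)
      (4 * (dcov_const CARD('p) * integral\<^sup>L (U n) (\<lambda>k. norm (?x k)) * (dcov_const CARD('q) * integral\<^sup>L (U n) (\<lambda>k. norm (?y k)))))" for n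
      using prob_space.has_bochner_integral_dcov_majorant[OF U[of n] meas meas int_U int_U, of ?x ?y] by simp
    have maj': "has_bochner_integral ?L (dcov_majorant M X Y)
      (4 * (dcov_const CARD('p) * expectation (\<lambda>\<omega>. norm (X \<omega>)) * (dcov_const CARD('q) * expectation (\<lambda>\<omega>. norm (Y \<omega>)))))"
      using has_bochner_integral_dcov_majorant[OF XY int] by simp
    have "(\<lambda>n. integral\<^sup>L ?L (dcov_integrand (U n) ?x ?y)) \<longlonglongrightarrow> integral\<^sup>L ?L (dcov_integrand M X Y)"
    proof (rule tendsto_integral_dominated_by_convergent)
      show "dcov_integrand (U n) ?x ?y \<in> borel_measurable ?L" for n
        using prob_space.borel_measurable_dcov_integrand[OF U meas meas] by simp
      show "dcov_integrand M X Y \<in> borel_measurable ?L"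
        using borel_measurable_dcov_integrand[OF XY] by simp
      show "integrable ?L (dcov_majorant (U n) ?x ?y)" for n
        using maj[of n] by (simp add: has_bochner_integral_iff)
      show "integrable ?L (dcov_majorant M X Y)"
        using maj' by (simp add: has_bochner_integral_iff)
      show "AE u in ?L. (\<lambda>n. dcov_integrand (U n) ?x ?y u) \<longlonglongrightarrow> dcov_integrand M X Y u"
        using lim_joint lim_X lim_Y
      proof eventually_elim
        case (elim u)
        show ?case
          unfolding dcov_integrand_def divide_inverse by (intro tendsto_intros elim)
      qed
      show "AE u in ?L. (\<lambda>n. dcov_majorant (U n) ?x ?y u) \<longlonglongrightarrow> dcov_majorant M X Y u"
        using lim_X lim_Y
      proof eventually_elim
        case (elim u)
        show ?case
          unfolding dcov_majorant_def divide_inverse by (intro tendsto_intros elim)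
      qed
      show "dcov_integrand (U n) ?x ?y u \<le> dcov_majorant (U n) ?x ?y u" for n u
        by (rule prob_space.dcov_integrand_le_majorant[OF U meas meas])
      show "dcov_integrand M X Y u \<le> dcov_majorant M X Y u" for u
        by (rule dcov_integrand_le_majorant[OF XY])
      have "(\<lambda>n. integral\<^sup>L (U n) (\<lambda>k. norm (?x k))) \<longlonglongrightarrow> expectation (\<lambda>\<omega>. norm (X \<omega>))"
        "(\<lambda>n. integral\<^sup>L (U n) (\<lambda>k. norm (?y k))) \<longlonglongrightarrow> expectation (\<lambda>\<omega>. norm (Y \<omega>))"
        unfolding avg using elim(1,2)[THEN LIMSEQ_Suc] by simp_all
      then show "(\<lambda>n. integral\<^sup>L ?L (dcov_majorant (U n) ?x ?y)) \<longlonglongrightarrow> integral\<^sup>L ?L (dcov_majorant M X Y)"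
        unfolding has_bochner_integral_integral_eq[OF maj] has_bochner_integral_integral_eq[OF maj']
        by (intro tendsto_intros)
    qed (rule dcov_integrand_nonneg)+
    then have "(\<lambda>n. dcov (U n) ?x ?y) \<longlonglongrightarrow> dcov M X Y"
      unfolding dcov_eq_integrand by (intro tendsto_intros)
    then have "(\<lambda>n. empirical_dcov (Suc n) ?x ?y) \<longlonglongrightarrow> dcov M X Y"
      by (simp add: empirical_dcov_eq_dcov U_def)
    then show ?case by (rule LIMSEQ_imp_Suc)
  qed
qed

end
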